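(* Suppose $R$ is a $\Phi$-structured poset, and suppose also that $\mathrm{WGF}(R)$ is $W$-invariant. Let $\mathcal S=\mathcal S_{I,0}(R)$ be a subset of $\{\mathbf x\in R:\delta_i(\mathbf x)=0\text{ for all }i\in I\}$. Suppose $\kappa:R\setminus\mathcal S\to I$ is a vertex-coloring function such that for each $\mathbf x\in R\setminus\mathcal S$ with $k:=\kappa(\mathbf x)$ we have: (1) $\mathrm{comp}_k(\mathbf x)$ is isomorphic to a product of chains and (2) $\mathsf K(\mathbf x)$ is a sub-face of $\mathrm{comp}_k(\mathbf x)$. Then $wt(\mathbf s)\in\Lambda^+$ for all $\mathbf s\in\mathcal S$ and $R$ is an $(I,0)$-splitting poset with $$\mathrm{WGF}(R)=\sum_{\mathbf s\in\mathcal S_{I,0}(R)}\chi^\Phi_{wt(\mathbf s)}.$$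
   Context: $\Phi$ is a finite (reduced, crystallographic) root system in a Euclidean space with simple roots $\{\alpha_i\}_{i\in I}$, $\alpha^\vee=2\alpha/\langle\alpha,\alpha\rangle$, fundamental weights $\omega_i$ dual to simple coroots, $\Lambda=\bigoplus\mathbb Z\omega_i$, $\Lambda^+=\bigoplus\mathbb Z_{\ge0}\omega_i$, Weyl group $W$, $\varrho=\sum\omega_i$. $\mathbb Z[\Lambda]$ is the group ring with basis $\{e^\mu\}$, $w.e^\mu=e^{w(\mu)}$; $\mathcal A(e^\mu)=\sum_{w\in W}\det(w)e^{w(\mu)}$. For $\lambda\in\Lambda^+$ the Weyl bialternant $\chi^\Phi_\lambda$ is the unique element of $\mathbb Z[\Lambda]$ with $\mathcal A(e^\varrho)\chi_\lambda=\mathcal A(e^{\lambda+\varrho})$. All posets are finite, identified with Hasse diagrams. Ranked means there is a surjection $\rho:R\to\{0,\dots,l\}$ with $\rho(\mathbf s)+1=\rho(\mathbf t)$ whenever $\mathbf t$ covers $\mathbf s$; $l$ is the length. For a ranked poset $R$ with Hasse edges colored by $I$, $\mathrm{comp}_i(\mathbf x)$ is the connected component of $\mathbf x$ using only color $i$ edges; $\rho_i(\mathbf x)$ is the rank of $\mathbf x$ there, $l_i(\mathbf x)$ its length, $\delta_i=l_i-\rho_i$, $m_i=\rho_i-\delta_i$, $wt(\mathbf x)=\sum_i m_i(\mathbf x)\omega_i$, $\mathrm{WGF}(R)=\sum_{\mathbf x}e^{wt(\mathbf x)}$. $R$ is $\Phi$-structured if $wt(\mathbf s)+\alpha_i=wt(\mathbf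 t)$ whenever $\mathbf s\xrightarrow{i}\mathbf t$. "$(I,0)$-splitting" means $R$ is $\Phi$-structured, $wt(\mathbf s)\in\Lambda^+$ for all $\mathbf s\in\mathcal S_{I,0}(R)$, and the displayed identity holds. Given $\mathcal S\subseteq R$ and $\kappa:R\setminus\mathcal S\to I$, the kindred set of $\mathbf x\in R\setminus\mathcal S$ is $\mathsf K(\mathbf x)=\{\mathbf y\in\mathrm{comp}_{\kappa(\mathbf x)}(\mathbf x):\mathbf y\in R\setminus\mathcal S,\ \kappa(\mathbf y)=\kappa(\mathbf x)\}$. Sub-faces. Let $\mathcal C=\mathcal C_1\times\cdots\times\mathcal C_p$ be a product of chains, not all one-element, and let $q$ be the largest index with $|\mathcal C_q|\ge2$; the sub-face of $\mathcal C$ is the set of $(\mathbf x_1,\dots,\mathbf x_p)\in\mathcal C$ with $\mathbf x_q$ not the top element of $\mathcal C_q$ (it is empty if all $\mathcal C_r$ have one element). A subset $S$ of a poset $P$ is a sub-face of $P$ if for some poset isomorphism $\phi$ from a product of chains $\mathcal C$ onto $P$, $\phi^{-1}(S)$ is the sub-face of $\mathcal C$. *)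

theory Defs
  imports "HOL-Analysis.Analysis" "HOL-Library.Poly_Mapping"
begin

section \<open>Root systems and weights\<close>

definition coroot :: "real^'n \<Rightarrow> real^'n" where
  "coroot a = (2 / (a \<bullet> a)) *\<^sub>R a"

definition reflection :: "real^'n \<Rightarrow> real^'n \<Rightarrow> real^'n" where
  "reflection a x = x - (x \<bullet> coroot a) *\<^sub>R a"

text \<open>The Euclidean space in which \<open>\<Phi>\<close> lives is \<open>span \<Phi>\<close>, an arbitrary subspace of the
  ambient \<open>real^'n\<close>. In particular the empty root system is allowed.\<close>

definition root_system :: "(real^'n) set \<Rightarrow> bool" where
  "root_system \<Phi> \<longleftrightarrow>
     finite \<Phi> \<and> 0 \<notin> \<Phi> \<and>
     (\<forall>a\<in>\<Phi>. reflection a ` \<Phi> = \<Phi>) \<and>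
     (\<forall>a\<in>\<Phi>. \<forall>c. c *\<^sub>R a \<in> \<Phi> \<longrightarrow> c = 1 \<or> c = - 1) \<and>
     (\<forall>a\<in>\<Phi>. \<forall>b\<in>\<Phi>. b \<bullet> coroot a \<in> \<int>)"

definition simple_roots :: "(real^'n) set \<Rightarrow> 'i set \<Rightarrow> ('i \<Rightarrow> real^'n) \<Rightarrow> bool" where
  "simple_roots \<Phi> I \<alpha> \<longleftrightarrow>
     inj_on \<alpha> I \<and> \<alpha> ` I \<subseteq> \<Phi> \<and> independent (\<alpha> ` I) \<and>
     (\<forall>b\<in>\<Phi>. \<exists>c :: 'i \<Rightarrow> int. b = (\<Sum>i\<in>I. of_int (c i) *\<^sub>R \<alpha> i) \<and>
        ((\<forall>i\<in>I. 0 \<le> c i) \<or> (\<forall>i\<in>I. c i \<le> 0)))"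

definition fund_weight :: "'i set \<Rightarrow> ('i \<Rightarrow> real^'n) \<Rightarrow> 'i \<Rightarrow> real^'n" where
  "fund_weight I \<alpha> i =
     (THE w. w \<in> span (\<alpha> ` I) \<and> (\<forall>j\<in>I. w \<bullet> coroot (\<alpha> j) = (if i = j then 1 else 0)))"

definition weight_lattice :: "'i set \<Rightarrow> ('i \<Rightarrow> real^'n) \<Rightarrow> (real^'n) set" where
  "weight_lattice I \<alpha> = range (\<lambda>c :: 'i \<Rightarrow> int. \<Sum>i\<in>I. of_int (c i) *\<^sub>R fund_weight I \<alpha> i)"

definition dominant_weights :: "'i set \<Rightarrow> ('i \<Rightarrow> real^'n) \<Rightarrow> (real^'n) set" where
  "dominant_weights I \<alpha> = range (\<lambda>c :: 'i \<Rightarrow> nat. \<Sum>i\<in>I. of_nat (c i) *\<^sub>R fund_weight I \<alpha> i)"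

definition weyl_rho :: "'i set \<Rightarrow> ('i \<Rightarrow> real^'n) \<Rightarrow> real^'n" where
  "weyl_rho I \<alpha> = (\<Sum>i\<in>I. fund_weight I \<alpha> i)"

text \<open>Reflections are involutions, so the monoid generated by them is a group.\<close>

inductive_set weyl_group :: "(real^'n) set \<Rightarrow> (real^'n \<Rightarrow> real^'n) set"
  for \<Phi> :: "(real^'n) set" where
  weyl_id: "id \<in> weyl_group \<Phi>"
| weyl_step: "w \<in> weyl_group \<Phi> \<Longrightarrow> a \<in> \<Phi> \<Longrightarrow> reflection a \<circ> w \<in> weyl_group \<Phi>"

section \<open>The group ring and Weyl bialternants\<close>

text \<open>\<open>\<int>[\<Lambda>]\<close> is the subring of the group ring \<open>(real^'n) \<Rightarrow>\<^sub>0 int\<close> consisting of the elements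
  whose keys lie in \<open>\<Lambda>\<close>; multiplication of finitely supported functions is convolution.\<close>

definition group_ring :: "(real^'n) set \<Rightarrow> ((real^'n) \<Rightarrow>\<^sub>0 int) set" where
  "group_ring L = {f. Poly_Mapping.keys f \<subseteq> L}"

definition expo :: "real^'n \<Rightarrow> (real^'n) \<Rightarrow>\<^sub>0 int" where
  "expo \<mu> = Poly_Mapping.single \<mu> 1"

text \<open>The additive extension of \<open>w.e\<^sup>\<mu> = e\<^bsup>w \<mu>\<^esup>\<close>.\<close>

definition weyl_act :: "(real^'n \<Rightarrow> real^'n) \<Rightarrow> ((real^'n) \<Rightarrow>\<^sub>0 int) \<Rightarrow> ((real^'n) \<Rightarrow>\<^sub>0 int)" where
  "weyl_act w f = (\<Sum>\<mu>\<in>Poly_Mapping.keys f. of_int (Poly_Mapping.lookup f \<mu>) * expo (w \<mu>))"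

definition weyl_invariant :: "(real^'n) set \<Rightarrow> ((real^'n) \<Rightarrow>\<^sub>0 int) \<Rightarrow> bool" where
  "weyl_invariant \<Phi> f \<longleftrightarrow> (\<forall>w\<in>weyl_group \<Phi>. weyl_act w f = f)"

text \<open>Weyl group elements fix the orthogonal complement of \<open>span \<Phi>\<close>, so the determinant on
  \<open>real^'n\<close> is the one on \<open>span \<Phi>\<close>. It is \<open>\<plusminus>1\<close>, and the floor only converts it to an integer.\<close>

definition alternant :: "(real^'n) set \<Rightarrow> real^'n \<Rightarrow> (real^'n) \<Rightarrow>\<^sub>0 int" where
  "alternant \<Phi> \<mu> = (\<Sum>w\<in>weyl_group \<Phi>. of_int \<lfloor>det (matrix w)\<rfloor> * expo (w \<mu>))"

definition bialternant ::
  "(real^'n) set \<Rightarrow> 'i set \<Rightarrow> ('i \<Rightarrow> real^'n) \<Rightarrow> real^'n \<Rightarrow> (real^'n) \<Rightarrow>\<^sub>0 int" where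
  "bialternant \<Phi> I \<alpha> l =
     (THE f. f \<in> group_ring (weight_lattice I \<alpha>) \<and>
        alternant \<Phi> (weyl_rho I \<alpha>) * f = alternant \<Phi> (l + weyl_rho I \<alpha>))"

section \<open>Ranked posets\<close>

text \<open>A poset is a carrier \<open>P\<close> with its order relation \<open>r\<close>; \<open>covers P r\<close> is the set of edges
  \<open>(s, t)\<close>, \<open>t\<close> covering \<open>s\<close>, of its Hasse diagram.\<close>

definition covers :: "'r set \<Rightarrow> 'r rel \<Rightarrow> 'r rel" where
  "covers P r = {(s, t). s \<in> P \<and> t \<in> P \<and> (s, t) \<in> r \<and> s \<noteq> t \<and>
     (\<forall>u\<in>P. (s, u) \<in> r \<and> (u, t) \<in> r \<longrightarrow> u = s \<or> u = t)}"

definition is_rank_function :: "'r set \<Rightarrow> 'r rel \<Rightarrow> ('r \<Rightarrow> nat) \<Rightarrow> nat \<Rightarrow> bool" where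
  "is_rank_function P r \<rho> l \<longleftrightarrow> \<rho> ` P = {0..l} \<and> (\<forall>(s, t)\<in>covers P r. \<rho> s + 1 = \<rho> t)"

definition ranked_poset :: "'r set \<Rightarrow> 'r rel \<Rightarrow> bool" where
  "ranked_poset P r \<longleftrightarrow> finite P \<and> partial_order_on P r \<and> (\<exists>\<rho> l. is_rank_function P r \<rho> l)"

text \<open>On the carrier of a connected ranked poset the rank function is unique; the two
  definitions below are only used for the monochromatic components, which are connected.\<close>

definition rank_in :: "'r set \<Rightarrow> 'r rel \<Rightarrow> 'r \<Rightarrow> nat" where
  "rank_in P r = (SOME \<rho>. \<exists>l. is_rank_function P r \<rho> l)"

definition poset_length :: "'r set \<Rightarrow> 'r rel \<Rightarrow> nat" where
  "poset_length P r = Max (rank_in P r ` P)"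

section \<open>Edge-colored ranked posets\<close>

text \<open>The color of the edge \<open>(s, t)\<close> is \<open>col (s, t)\<close>; values of \<open>col\<close> off the edges are ignored.\<close>

definition colored_ranked_poset ::
  "'i set \<Rightarrow> 'r set \<Rightarrow> 'r rel \<Rightarrow> ('r \<times> 'r \<Rightarrow> 'i) \<Rightarrow> bool" where
  "colored_ranked_poset I R r col \<longleftrightarrow> ranked_poset R r \<and> col ` covers R r \<subseteq> I"

definition edges :: "'r set \<Rightarrow> 'r rel \<Rightarrow> ('r \<times> 'r \<Rightarrow> 'i) \<Rightarrow> 'i \<Rightarrow> 'r rel" where
  "edges R r col i = {e \<in> covers R r. col e = i}"

definition color_comp :: "'r set \<Rightarrow> 'r rel \<Rightarrow> ('r \<times> 'r \<Rightarrow> 'i) \<Rightarrow> 'i \<Rightarrow> 'r \<Rightarrow> 'r set" where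
  "color_comp R r col i x = (edges R r col i \<union> (edges R r col i)\<inverse>)\<^sup>* `` {x}"

text \<open>A component is the poset whose Hasse diagram is given by its edges of color \<open>i\<close>, that is,
  its order is generated by these edges.\<close>

definition comp_ord :: "'r set \<Rightarrow> 'r rel \<Rightarrow> ('r \<times> 'r \<Rightarrow> 'i) \<Rightarrow> 'i \<Rightarrow> 'r \<Rightarrow> 'r rel" where
  "comp_ord R r col i x = Restr ((edges R r col i)\<^sup>*) (color_comp R r col i x)"

text \<open>For the color \<open>i\<close> component of \<open>x\<close>: \<open>comp_rank\<close> is \<open>\<rho>\<^sub>i(x)\<close>, \<open>comp_length\<close> is \<open>l\<^sub>i(x)\<close>,
  \<open>comp_depth\<close> is \<open>\<delta>\<^sub>i(x)\<close>, and \<open>m\<^sub>i(x) = \<rho>\<^sub>i(x) - \<delta>\<^sub>i(x)\<close>.\<close>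

definition comp_rank :: "'r set \<Rightarrow> 'r rel \<Rightarrow> ('r \<times> 'r \<Rightarrow> 'i) \<Rightarrow> 'i \<Rightarrow> 'r \<Rightarrow> int" where
  "comp_rank R r col i x = int (rank_in (color_comp R r col i x) (comp_ord R r col i x) x)"

definition comp_length :: "'r set \<Rightarrow> 'r rel \<Rightarrow> ('r \<times> 'r \<Rightarrow> 'i) \<Rightarrow> 'i \<Rightarrow> 'r \<Rightarrow> int" where
  "comp_length R r col i x = int (poset_length (color_comp R r col i x) (comp_ord R r col i x))"

definition comp_depth :: "'r set \<Rightarrow> 'r rel \<Rightarrow> ('r \<times> 'r \<Rightarrow> 'i) \<Rightarrow> 'i \<Rightarrow> 'r \<Rightarrow> int" where
  "comp_depth R r col i x = comp_length R r col i x - comp_rank R r col i x"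

definition wt ::
  "'i set \<Rightarrow> ('i \<Rightarrow> real^'n) \<Rightarrow> 'r set \<Rightarrow> 'r rel \<Rightarrow> ('r \<times> 'r \<Rightarrow> 'i) \<Rightarrow> 'r \<Rightarrow> real^'n" where
  "wt I \<alpha> R r col x =
     (\<Sum>i\<in>I. of_int (comp_rank R r col i x - comp_depth R r col i x) *\<^sub>R fund_weight I \<alpha> i)"

definition WGF ::
  "'i set \<Rightarrow> ('i \<Rightarrow> real^'n) \<Rightarrow> 'r set \<Rightarrow> 'r rel \<Rightarrow> ('r \<times> 'r \<Rightarrow> 'i) \<Rightarrow> (real^'n) \<Rightarrow>\<^sub>0 int" where
  "WGF I \<alpha> R r col = (\<Sum>x\<in>R. expo (wt I \<alpha> R r col x))"

definition structured_poset ::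
  "'i set \<Rightarrow> ('i \<Rightarrow> real^'n) \<Rightarrow> 'r set \<Rightarrow> 'r rel \<Rightarrow> ('r \<times> 'r \<Rightarrow> 'i) \<Rightarrow> bool" where
  "structured_poset I \<alpha> R r col \<longleftrightarrow>
     colored_ranked_poset I R r col \<and>
     (\<forall>i\<in>I. \<forall>(s, t)\<in>edges R r col i. wt I \<alpha> R r col s + \<alpha> i = wt I \<alpha> R r col t)"

text \<open>\<open>(I,0)\<close>-splitting, with \<open>S\<close> in the role of \<open>S\<^bsub>I,0\<^esub>(R)\<close>.\<close>

definition splitting_poset ::
  "(real^'n) set \<Rightarrow> 'i set \<Rightarrow> ('i \<Rightarrow> real^'n) \<Rightarrow> 'r set \<Rightarrow> 'r rel \<Rightarrow> ('r \<times> 'r \<Rightarrow> 'i) \<Rightarrow> 'r set \<Rightarrow> bool"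
where
  "splitting_poset \<Phi> I \<alpha> R r col S \<longleftrightarrow>
     structured_poset I \<alpha> R r col \<and> S \<subseteq> R \<and>
     (\<forall>s\<in>S. wt I \<alpha> R r col s \<in> dominant_weights I \<alpha>) \<and>
     WGF I \<alpha> R r col = (\<Sum>s\<in>S. bialternant \<Phi> I \<alpha> (wt I \<alpha> R r col s))"

definition kindred ::
  "'r set \<Rightarrow> 'r rel \<Rightarrow> ('r \<times> 'r \<Rightarrow> 'i) \<Rightarrow> 'r set \<Rightarrow> ('r \<Rightarrow> 'i) \<Rightarrow> 'r \<Rightarrow> 'r set" where
  "kindred R r col S \<kappa> x = {y \<in> color_comp R r col (\<kappa> x) x. y \<in> R - S \<and> \<kappa> y = \<kappa> x}"

section \<open>Products of chains and sub-faces\<close>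

text \<open>Finite nonempty chains are represented, up to isomorphism, as \<open>{0, \<dots>, n - 1}\<close> with
  \<open>n > 0\<close>; the product of the chains of sizes \<open>ns ! 0, ns ! 1, \<dots>\<close> consists of lists with the
  componentwise order.\<close>

definition chain_sizes :: "nat list \<Rightarrow> bool" where
  "chain_sizes ns \<longleftrightarrow> (\<forall>n\<in>set ns. 0 < n)"

definition chain_prod :: "nat list \<Rightarrow> nat list set" where
  "chain_prod ns = {xs. list_all2 (<) xs ns}"

definition chain_prod_ord :: "nat list \<Rightarrow> nat list rel" where
  "chain_prod_ord ns = {(xs, ys). xs \<in> chain_prod ns \<and> ys \<in> chain_prod ns \<and> list_all2 (\<le>) xs ys}"

definition sub_face :: "nat list \<Rightarrow> nat list set" where
  "sub_face ns =
     (if \<exists>q<length ns. 2 \<le> ns ! q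
      then let q = Max {q. q < length ns \<and> 2 \<le> ns ! q}
           in {xs \<in> chain_prod ns. xs ! q \<noteq> ns ! q - 1}
      else {})"

definition poset_iso :: "('a \<Rightarrow> 'b) \<Rightarrow> 'a set \<Rightarrow> 'a rel \<Rightarrow> 'b set \<Rightarrow> 'b rel \<Rightarrow> bool" where
  "poset_iso \<phi> P r Q s \<longleftrightarrow>
     bij_betw \<phi> P Q \<and> (\<forall>x\<in>P. \<forall>y\<in>P. (x, y) \<in> r \<longleftrightarrow> (\<phi> x, \<phi> y) \<in> s)"

definition iso_chain_prod :: "'r set \<Rightarrow> 'r rel \<Rightarrow> bool" where
  "iso_chain_prod P r \<longleftrightarrow>
     (\<exists>ns \<phi>. chain_sizes ns \<and> poset_iso \<phi> (chain_prod ns) (chain_prod_ord ns) P r)"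

definition is_sub_face :: "'r set \<Rightarrow> 'r set \<Rightarrow> 'r rel \<Rightarrow> bool" where
  "is_sub_face S P r \<longleftrightarrow> S \<subseteq> P \<and>
     (\<exists>ns \<phi>. chain_sizes ns \<and> poset_iso \<phi> (chain_prod ns) (chain_prod_ord ns) P r \<and>
        {xs \<in> chain_prod ns. \<phi> xs \<in> S} = sub_face ns)"

end

theory Submission
  imports Defs
begin

text \<open>Write \<open>A(\<mu>)\<close> for \<open>\<A>(e\<^sup>\<mu>)\<close>. Since \<open>WGF(R)\<close> is invariant,
  \<open>A(\<rho>) WGF(R) = \<Sum>\<^sub>x A(\<rho> + wt(x))\<close>, summed over \<open>x \<in> R\<close>. The kindred sets partition \<open>R - S\<close>.
  A sub-face is again a product of chains, so it has an order-reversing bijection; on a kindred set of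
  color \<open>k\<close> this bijection realizes the reflection \<open>s\<^sub>k\<close> on the weights \<open>\<rho> + wt(x)\<close>, hence the part of the
  sum over that set equals its own negative and vanishes. What remains is the sum over \<open>S\<close>, whose
  weights are dominant because all depths are 0, and \<open>A(\<rho>)\<close> can be cancelled: it is not a zero divisor.

  That \<open>A(\<rho>)\<close> divides \<open>A(\<lambda> + \<rho>)\<close> for dominant \<open>\<lambda>\<close> follows by induction on \<open>norm (\<lambda> + \<rho>)\<close>,
  expanding the product of \<open>A(\<rho>)\<close> with the orbit sum of \<open>\<lambda>\<close>.\<close>

section \<open>Reflections\<close>

lemma linear_reflection: "linear (reflection a)"
  by (intro linearI) (simp_all add: reflection_def algebra_simps)

lemma reflection_inner: "reflection a x \<bullet> y = x \<bullet> y - (x \<bullet> coroot a) * (y \<bullet> a)"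
  by (simp add: reflection_def inner_diff_left inner_commute[of a y])

lemma reflection_self: "reflection a a = - a"
  by (cases "a = 0") (simp_all add: reflection_def coroot_def scaleR_2)

lemma inner_reflection: "reflection a x \<bullet> reflection a y = x \<bullet> y"
  by (cases "a = 0") (simp_all add: reflection_def coroot_def algebra_simps inner_commute)

lemma reflection_reflection [simp]: "reflection a (reflection a x) = x"
  by (cases "a = 0") (simp_all add: reflection_def coroot_def algebra_simps inner_commute flip: scaleR_2)

lemma reflection_comp_reflection: "reflection a \<circ> reflection a = id"
  by auto

lemma inner_reflection_left: "reflection a x \<bullet> y = x \<bullet> reflection a y"
  using inner_reflection[of a x "reflection a y"] by simp

lemma reflection_conjugate:
  assumes "linear g" "\<And>x y. g x \<bullet> g y = x \<bullet> y"
  shows "g (reflection a x) = reflection (g a) (g x)"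
  using assms by (simp add: reflection_def coroot_def linear_diff linear_scale)

text \<open>Conjugation by an orthogonal map moves the mirror to a coordinate hyperplane, where the
  matrix is diagonal with a single entry -1.\<close>

lemma det_reflection:
  fixes a :: "real^'n"
  assumes "a \<noteq> 0"
  shows "det (matrix (reflection a)) = - 1"
proof -
  obtain k :: 'n where True by simp
  \<comment> \<open>Equal norms guarantee an orthogonal map taking \<open>b\<close> to
    \<open>a\<close>; the coordinate \<open>k\<close> is arbitrary.\<close>
  define b :: "real^'n" where "b = norm a *\<^sub>R axis k 1"
  have "norm b = norm a" by (simp add: b_def)
  then obtain f where f: "orthogonal_transformation f" "f b = a"
    using orthogonal_transformation_exists[of b a] by metis
  have lf: "linear f" and inner_f: "f x \<bullet> f y = x \<bullet> y" for x y
    using f(1) by (auto simp: orthogonal_transformation_def)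
  have "f \<circ> reflection b = reflection a \<circ> f"
    using reflection_conjugate[OF lf inner_f] f(2) by auto
  then have "matrix f ** matrix (reflection b) = matrix (reflection a) ** matrix f"
    by (metis lf linear_reflection matrix_compose)
  then have "det (matrix f) * det (matrix (reflection b)) = det (matrix (reflection a)) * det (matrix f)"
    by (metis det_mul)
  moreover have "det (matrix f) \<noteq> 0"
    using det_orthogonal_matrix[of "matrix f"] f(1) orthogonal_transformation_matrix by fastforce
  moreover have "det (matrix (reflection b)) = - 1"
  proof -
    have refl_b: "reflection b x = x - (2 * x $ k) *\<^sub>R axis k 1" for x
      using assms by (simp add: reflection_def b_def coroot_def inner_axis power2_eq_square[symmetric])
        (simp add: power2_eq_square)
    have diag: "matrix (reflection b) $ i $ j = (if i = j then (if i = k then - 1 else 1) else 0)" for i j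
      by (auto simp: matrix_def refl_b axis_def)
    then show ?thesis
      by (subst det_diagonal) (simp_all add: diag)
  qed
  ultimately have "(det (matrix (reflection a)) + 1) * det (matrix f) = 0"
    by (simp add: algebra_simps)
  then show ?thesis using \<open>det (matrix f) \<noteq> 0\<close> by simp
qed

text \<open>A coroot is a positive multiple of its root, so integrality can be tested against
  coroots and signs against roots.\<close>

lemma coroot_inner_iff:
  assumes "a \<noteq> 0"
  shows coroot_inner_pos_iff: "0 < x \<bullet> coroot a \<longleftrightarrow> 0 < x \<bullet> a"
    and coroot_inner_nonneg_iff: "0 \<le> x \<bullet> coroot a \<longleftrightarrow> 0 \<le> x \<bullet> a"
proof -
  define c where "c = 2 / (a \<bullet> a)"
  have "0 < c" "x \<bullet> coroot a = c * (x \<bullet> a)"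
    using assms by (simp_all add: c_def coroot_def)
  then show "0 < x \<bullet> coroot a \<longleftrightarrow> 0 < x \<bullet> a" "0 \<le> x \<bullet> coroot a \<longleftrightarrow> 0 \<le> x \<bullet> a"
    by (auto simp: zero_less_mult_iff zero_le_mult_iff)
qed

section \<open>The Weyl group\<close>

lemma weyl_linear: "w \<in> weyl_group \<Phi> \<Longrightarrow> linear w"
proof (induction rule: weyl_group.induct)
  case weyl_id
  show ?case by (rule linear_id)
next
  case (weyl_step w a)
  show ?case by (rule linear_compose[OF weyl_step.IH linear_reflection])
qed

lemma weyl_inner: "w \<in> weyl_group \<Phi> \<Longrightarrow> w x \<bullet> w y = x \<bullet> y"
  by (induction rule: weyl_group.induct) (auto simp: inner_reflection)

lemma weyl_comp: "u \<in> weyl_group \<Phi> \<Longrightarrow> v \<in> weyl_group \<Phi> \<Longrightarrow> u \<circ> v \<in> weyl_group \<Phi>"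
  by (induction rule: weyl_group.induct) (auto simp: comp_assoc intro: weyl_group.intros)

lemma weyl_reflection: "a \<in> \<Phi> \<Longrightarrow> reflection a \<in> weyl_group \<Phi>"
  using weyl_step[OF weyl_id] by simp

lemma weyl_inj: "w \<in> weyl_group \<Phi> \<Longrightarrow> inj w"
  by (metis (no_types, lifting) injI weyl_inner vector_eq)

lemma det_weyl:
  assumes "w \<in> weyl_group \<Phi>"
  shows "det (matrix w) = 1 \<or> det (matrix w) = - 1"
proof -
  have "orthogonal_transformation w"
    using assms by (auto simp: orthogonal_transformation_def weyl_linear weyl_inner)
  then show ?thesis
    using det_orthogonal_matrix orthogonal_transformation_matrix by blast
qed

lemma det_weyl_reflection:
  assumes "w \<in> weyl_group \<Phi>" "a \<noteq> 0"
  shows "\<lfloor>det (matrix (w \<circ> reflection a))\<rfloor> = - \<lfloor>det (matrix w)\<rfloor>"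
proof -
  have "det (matrix (w \<circ> reflection a)) = - det (matrix w)"
    using assms by (simp add: matrix_compose[OF linear_reflection weyl_linear] det_mul det_reflection)
  then show ?thesis
    using det_weyl[OF assms(1)] floor_of_int[of "- 1", where 'a = real] by auto
qed

section \<open>Antisymmetry of alternants\<close>

text \<open>Right translation by the reflection permutes the Weyl group and changes the sign of each
  determinant.\<close>

lemma alternant_reflection:
  assumes "a \<in> \<Phi>" "a \<noteq> 0"
  shows "alternant \<Phi> (reflection a \<mu>) = - alternant \<Phi> \<mu>"
proof -
  let ?s = "\<lambda>w. w \<circ> reflection a"
  have "bij_betw ?s (weyl_group \<Phi>) (weyl_group \<Phi>)"
    by (rule bij_betwI[of _ _ _ ?s])
      (auto intro: weyl_comp weyl_reflection assms simp: comp_assoc reflection_comp_reflection)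
  then have "alternant \<Phi> (reflection a \<mu>) =
      (\<Sum>w\<in>weyl_group \<Phi>. of_int \<lfloor>det (matrix (?s w))\<rfloor> * expo (?s w (reflection a \<mu>)))"
    unfolding alternant_def by (rule sum.reindex_bij_betw[symmetric])
  also have "\<dots> = (\<Sum>w\<in>weyl_group \<Phi>. - (of_int \<lfloor>det (matrix w)\<rfloor> * expo (w \<mu>)))"
    using assms(2) by (intro sum.cong) (simp_all add: det_weyl_reflection)
  finally show ?thesis by (simp add: alternant_def sum_negf)
qed

text \<open>Integer coefficients have no 2-torsion; this turns the sign-reversing symmetries below
  into vanishing statements.\<close>

lemma poly_mapping_eq_uminus_imp_zero:
  fixes f :: "'a \<Rightarrow>\<^sub>0 int"
  assumes "f = - f"
  shows "f = 0"
proof (rule poly_mapping_eqI)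
  fix k
  show "Poly_Mapping.lookup f k = Poly_Mapping.lookup 0 k"
    using arg_cong[OF assms, of "\<lambda>g. Poly_Mapping.lookup g k"] by simp
qed

lemma alternant_wall:
  assumes "a \<in> \<Phi>" "a \<noteq> 0" "\<mu> \<bullet> a = 0"
  shows "alternant \<Phi> \<mu> = 0"
proof -
  have "reflection a \<mu> = \<mu>" using assms by (simp add: reflection_def coroot_def)
  then show ?thesis
    using alternant_reflection[OF assms(1,2), of \<mu>] poly_mapping_eq_uminus_imp_zero by metis
qed

text \<open>Each generating reflection contributes one sign. Which sign results is left open, since
  divisibility of an alternant does not depend on it.\<close>

lemma alternant_weyl:
  assumes "0 \<notin> \<Phi>" "w \<in> weyl_group \<Phi>"
  shows "alternant \<Phi> (w \<mu>) = alternant \<Phi> \<mu> \<or> alternant \<Phi> (w \<mu>) = - alternant \<Phi> \<mu>"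
  using assms(2)
proof (induction rule: weyl_group.induct)
  case (weyl_step w a)
  then have "a \<noteq> 0" using assms(1) by auto
  then show ?case using weyl_step alternant_reflection by fastforce
qed simp

lemma weyl_root:
  assumes "root_system \<Phi>" "w \<in> weyl_group \<Phi>"
  shows "b \<in> \<Phi> \<Longrightarrow> w b \<in> \<Phi>"
  using assms(2)
proof (induction rule: weyl_group.induct)
  case (weyl_step w a)
  then have "reflection a ` \<Phi> = \<Phi>" using assms(1) by (auto simp: root_system_def)
  then show ?case using weyl_step by auto
qed simp

lemma weyl_fixes_orthogonal:
  assumes "w \<in> weyl_group \<Phi>" "\<And>b. b \<in> \<Phi> \<Longrightarrow> z \<bullet> b = 0"
  shows "w z = z"
  using assms(1)
  by (induction rule: weyl_group.induct) (auto simp: reflection_def coroot_def assms(2))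

text \<open>An element is determined by how it permutes the roots, because it fixes the orthogonal
  complement of their span; so the group embeds in the finite set of maps from \<open>\<Phi>\<close>
  to itself.\<close>

lemma finite_weyl_group:
  assumes "root_system \<Phi>"
  shows "finite (weyl_group \<Phi>)"
proof -
  let ?r = "\<lambda>w. restrict w \<Phi>"
  have "?r ` weyl_group \<Phi> \<subseteq> PiE \<Phi> (\<lambda>_. \<Phi>)"
    using weyl_root[OF assms] by auto
  moreover have "finite (PiE \<Phi> (\<lambda>_. \<Phi>))"
    using assms by (intro finite_PiE) (auto simp: root_system_def)
  moreover have "inj_on ?r (weyl_group \<Phi>)"
  proof (rule inj_onI, rule ext)
    fix u v x assume uv: "u \<in> weyl_group \<Phi>" "v \<in> weyl_group \<Phi>" "?r u = ?r v"
    obtain y z where yz: "y \<in> span \<Phi>" "\<And>b. b \<in> span \<Phi> \<Longrightarrow> orthogonal z b" "x = y + z"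
      using orthogonal_subspace_decomp_exists[of \<Phi> x] by metis
    have "z \<bullet> b = 0" if "b \<in> \<Phi>" for b
      using yz(2)[OF span_base[OF that]] by (simp add: orthogonal_def)
    then have "u z = z" "v z = z"
      using uv(1,2) weyl_fixes_orthogonal by blast+
    moreover have "u y = v y"
    proof (rule linear_eq_on_span[OF weyl_linear weyl_linear _ yz(1)])
      fix b assume "b \<in> \<Phi>"
      then show "u b = v b" using uv(3) by (metis restrict_apply')
    qed (use uv in auto)
    ultimately show "u x = v x"
      using uv weyl_linear yz(3) by (metis linear_add)
  qed
  ultimately show ?thesis
    by (meson finite_subset finite_imageD)
qed

section \<open>Dominant weights\<close>

locale based_root_system =
  fixes \<Phi> :: "(real^'n) set" and I :: "'i set" and \<alpha> :: "'i \<Rightarrow> real^'n"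
  assumes root_system: "root_system \<Phi>"
    and simple_roots: "simple_roots \<Phi> I \<alpha>"
begin

abbreviation \<omega> :: "'i \<Rightarrow> real^'n" where "\<omega> \<equiv> fund_weight I \<alpha>"
abbreviation \<rho> :: "real^'n" where "\<rho> \<equiv> weyl_rho I \<alpha>"
abbreviation W :: "(real^'n \<Rightarrow> real^'n) set" where "W \<equiv> weyl_group \<Phi>"
abbreviation A :: "real^'n \<Rightarrow> (real^'n) \<Rightarrow>\<^sub>0 int" where "A \<equiv> alternant \<Phi>"

lemma finite_roots: "finite \<Phi>" and zero_not_root: "0 \<notin> \<Phi>"
  using root_system by (auto simp: root_system_def)

lemma simple_root: "i \<in> I \<Longrightarrow> \<alpha> i \<in> \<Phi>"
  using simple_roots by (auto simp: simple_roots_def)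

lemma simple_nonzero: "i \<in> I \<Longrightarrow> \<alpha> i \<noteq> 0"
  using simple_root zero_not_root by metis

lemma inj_simple: "inj_on \<alpha> I"
  using simple_roots by (auto simp: simple_roots_def)

lemma finite_index: "finite I"
proof -
  have "finite (\<alpha> ` I)"
    using simple_roots finite_roots by (auto simp: simple_roots_def intro: finite_subset)
  then show ?thesis by (rule finite_imageD[OF _ inj_simple])
qed

lemma root_in_span: "b \<in> \<Phi> \<Longrightarrow> b \<in> span (\<alpha> ` I)"
proof -
  assume "b \<in> \<Phi>"
  then obtain c :: "'i \<Rightarrow> int" where "b = (\<Sum>i\<in>I. of_int (c i) *\<^sub>R \<alpha> i)"
    using simple_roots by (auto simp: simple_roots_def)
  then show ?thesis by (auto intro!: span_sum span_scale intro: span_base)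
qed

lemma inner_coroot_int: "a \<in> \<Phi> \<Longrightarrow> b \<in> \<Phi> \<Longrightarrow> b \<bullet> coroot a \<in> \<int>"
  using root_system by (auto simp: root_system_def)

text \<open>The difference is orthogonal to every simple root yet lies in their span, so it is 0.
  Pairings with simple coroots thus serve as coordinates.\<close>

lemma span_eqI:
  assumes "v \<in> span (\<alpha> ` I)" "w \<in> span (\<alpha> ` I)" "\<And>i. i \<in> I \<Longrightarrow> v \<bullet> coroot (\<alpha> i) = w \<bullet> coroot (\<alpha> i)"
  shows "v = w"
proof -
  have "orthogonal (v - w) b" if "b \<in> \<alpha> ` I" for b
    using assms(3) that simple_nonzero by (fastforce simp: orthogonal_def coroot_def algebra_simps)
  then have "orthogonal (v - w) (v - w)"
    using orthogonal_to_span assms(1,2) span_diff by blast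
  then show ?thesis by (simp add: orthogonal_self)
qed

text \<open>Independence yields a functional with prescribed values on the simple roots; its
  representing vector, projected to their span, is the required one.\<close>

lemma fund_weight_exists:
  assumes i: "i \<in> I"
  shows "\<exists>w. w \<in> span (\<alpha> ` I) \<and> (\<forall>j\<in>I. w \<bullet> coroot (\<alpha> j) = (if i = j then 1 else 0))"
proof -
  have "independent (\<alpha> ` I)" using simple_roots by (simp add: simple_roots_def)
  \<comment> \<open>The value \<open>(\<alpha> i \<bullet> \<alpha> i) / 2\<close> becomes 1 after
    the scaling in \<open>coroot (\<alpha> i)\<close>.\<close>
  then obtain g :: "real^'n \<Rightarrow> real" where g: "linear g"
      "\<And>b. b \<in> \<alpha> ` I \<Longrightarrow> g b = (if b = \<alpha> i then (\<alpha> i \<bullet> \<alpha> i) / 2 else 0)"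
    using linear_independent_extend[of "\<alpha> ` I" "\<lambda>b. if b = \<alpha> i then (\<alpha> i \<bullet> \<alpha> i) / 2 else 0"] by auto
  \<comment> \<open>\<open>adjoint g 1\<close> is the vector representing \<open>g\<close> through
    the inner product.\<close>
  define v where "v = adjoint g 1"
  have v: "g x = v \<bullet> x" for x
    using adjoint_works[OF g(1), of x 1] by (simp add: v_def inner_commute)
  obtain y z where yz: "y \<in> span (\<alpha> ` I)" "\<And>b. b \<in> span (\<alpha> ` I) \<Longrightarrow> orthogonal z b" "v = y + z"
    using orthogonal_subspace_decomp_exists[of "\<alpha> ` I" v] by metis
  have "y \<bullet> coroot (\<alpha> j) = (if i = j then 1 else 0)" if j: "j \<in> I" for j
  proof -
    have "z \<bullet> \<alpha> j = 0" using yz(2) j by (simp add: orthogonal_def span_base)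
    then have "y \<bullet> \<alpha> j = g (\<alpha> j)" by (simp add: v yz(3) inner_add_left)
    also have "\<dots> = (if i = j then (\<alpha> i \<bullet> \<alpha> i) / 2 else 0)"
      using g(2) i j inj_simple by (auto simp: inj_on_def)
    finally show ?thesis using simple_nonzero[OF i] by (auto simp: coroot_def)
  qed
  then show ?thesis using yz(1) by blast
qed

lemma fund_weight:
  assumes "i \<in> I"
  shows fund_weight_in_span: "\<omega> i \<in> span (\<alpha> ` I)"
    and fund_weight_coroot: "j \<in> I \<Longrightarrow> \<omega> i \<bullet> coroot (\<alpha> j) = (if i = j then 1 else 0)"
proof -
  have "\<exists>!w. w \<in> span (\<alpha> ` I) \<and> (\<forall>j\<in>I. w \<bullet> coroot (\<alpha> j) = (if i = j then 1 else 0))"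
    using fund_weight_exists[OF assms] by (metis (no_types, lifting) span_eqI)
  from theI'[OF this] show "\<omega> i \<in> span (\<alpha> ` I)" "j \<in> I \<Longrightarrow> \<omega> i \<bullet> coroot (\<alpha> j) = (if i = j then 1 else 0)"
    by (auto simp: fund_weight_def)
qed

lemma combination_coroot:
  assumes "j \<in> I"
  shows "(\<Sum>i\<in>I. c i *\<^sub>R \<omega> i) \<bullet> coroot (\<alpha> j) = c j"
proof -
  have "(\<Sum>i\<in>I. c i *\<^sub>R \<omega> i) \<bullet> coroot (\<alpha> j) = (\<Sum>i\<in>I. if i = j then c i else 0)"
    using assms by (auto simp: inner_sum_left fund_weight_coroot intro!: sum.cong)
  then show ?thesis using assms finite_index by simp
qed

lemma combination_in_span: "(\<Sum>i\<in>I. c i *\<^sub>R \<omega> i) \<in> span (\<alpha> ` I)"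
  by (intro span_sum span_scale fund_weight_in_span)

lemma weight_expansion:
  assumes "v \<in> span (\<alpha> ` I)"
  shows "v = (\<Sum>i\<in>I. (v \<bullet> coroot (\<alpha> i)) *\<^sub>R \<omega> i)"
  by (rule span_eqI) (auto simp: assms combination_in_span combination_coroot)

lemma weight_lattice_iff:
  "v \<in> weight_lattice I \<alpha> \<longleftrightarrow> v \<in> span (\<alpha> ` I) \<and> (\<forall>i\<in>I. v \<bullet> coroot (\<alpha> i) \<in> \<int>)"
proof
  assume "v \<in> weight_lattice I \<alpha>"
  then show "v \<in> span (\<alpha> ` I) \<and> (\<forall>i\<in>I. v \<bullet> coroot (\<alpha> i) \<in> \<int>)"
    by (auto simp: weight_lattice_def combination_in_span combination_coroot)
next
  assume v: "v \<in> span (\<alpha> ` I) \<and> (\<forall>i\<in>I. v \<bullet> coroot (\<alpha> i) \<in> \<int>)"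
  then have "v = (\<Sum>i\<in>I. of_int \<lfloor>v \<bullet> coroot (\<alpha> i)\<rfloor> *\<^sub>R \<omega> i)"
    by (subst weight_expansion) (auto intro!: sum.cong)
  then show "v \<in> weight_lattice I \<alpha>"
    unfolding weight_lattice_def
    by (rule image_eqI[where x = "\<lambda>i. \<lfloor>v \<bullet> coroot (\<alpha> i)\<rfloor>", OF _ UNIV_I])
qed

lemma dominant_weights_iff:
  "v \<in> dominant_weights I \<alpha> \<longleftrightarrow> v \<in> weight_lattice I \<alpha> \<and> (\<forall>i\<in>I. 0 \<le> v \<bullet> \<alpha> i)"
proof
  assume v: "v \<in> dominant_weights I \<alpha>"
  then obtain c :: "'i \<Rightarrow> nat" where c: "v = (\<Sum>i\<in>I. of_nat (c i) *\<^sub>R \<omega> i)"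
    by (auto simp: dominant_weights_def)
  have "0 \<le> v \<bullet> coroot (\<alpha> i)" "v \<bullet> coroot (\<alpha> i) \<in> \<int>" if "i \<in> I" for i
    using that by (auto simp: c combination_coroot)
  moreover have "v \<in> span (\<alpha> ` I)"
    unfolding c by (rule combination_in_span)
  ultimately show "v \<in> weight_lattice I \<alpha> \<and> (\<forall>i\<in>I. 0 \<le> v \<bullet> \<alpha> i)"
    using coroot_inner_nonneg_iff[OF simple_nonzero] by (simp add: weight_lattice_iff)
next
  assume v: "v \<in> weight_lattice I \<alpha> \<and> (\<forall>i\<in>I. 0 \<le> v \<bullet> \<alpha> i)"
  have "v \<bullet> coroot (\<alpha> i) = of_nat (nat \<lfloor>v \<bullet> coroot (\<alpha> i)\<rfloor>)" if i: "i \<in> I" for i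
  proof -
    have "0 \<le> v \<bullet> coroot (\<alpha> i)" using v i simple_nonzero coroot_inner_nonneg_iff by auto
    then show ?thesis using v i by (auto simp: weight_lattice_iff)
  qed
  then have "v = (\<Sum>i\<in>I. of_nat (nat \<lfloor>v \<bullet> coroot (\<alpha> i)\<rfloor>) *\<^sub>R \<omega> i)"
    using v by (subst weight_expansion) (auto simp: weight_lattice_iff intro!: sum.cong)
  then show "v \<in> dominant_weights I \<alpha>"
    unfolding dominant_weights_def
    by (rule image_eqI[where x = "\<lambda>i. nat \<lfloor>v \<bullet> coroot (\<alpha> i)\<rfloor>", OF _ UNIV_I])
qed

lemma rho_in_span: "\<rho> \<in> span (\<alpha> ` I)"
  using combination_in_span[of "\<lambda>_. 1"] by (simp add: weyl_rho_def)

lemma rho_coroot: "i \<in> I \<Longrightarrow> \<rho> \<bullet> coroot (\<alpha> i) = 1"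
  using combination_coroot[of i "\<lambda>_. 1"] by (simp add: weyl_rho_def)

lemma rho_simple_pos: "i \<in> I \<Longrightarrow> 0 < \<rho> \<bullet> \<alpha> i"
  using rho_coroot coroot_inner_pos_iff simple_nonzero by (metis zero_less_one)

lemma fund_weight_simple:
  "i \<in> I \<Longrightarrow> j \<in> I \<Longrightarrow> \<alpha> j \<bullet> \<omega> i = (if i = j then (\<alpha> i \<bullet> \<alpha> i) / 2 else 0)"
  using fund_weight_coroot[of i j] simple_nonzero[of j]
  by (auto simp: coroot_def inner_commute split: if_splits)

text \<open>Dual to \<open>weight_expansion\<close>: simple coroots and fundamental weights are dual
  bases of the span.\<close>

lemma coroot_expansion:
  assumes "v \<in> span (\<alpha> ` I)"
  shows "v = (\<Sum>i\<in>I. (v \<bullet> \<omega> i) *\<^sub>R coroot (\<alpha> i))"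
proof (rule vector_eq_dot_span[OF assms])
  show "(\<Sum>i\<in>I. (v \<bullet> \<omega> i) *\<^sub>R coroot (\<alpha> i)) \<in> span (\<alpha> ` I)"
    by (auto simp: coroot_def intro!: span_sum span_scale intro: span_base)
  fix b assume "b \<in> \<alpha> ` I"
  then have b: "b \<in> span (\<alpha> ` I)" by (simp add: span_base)
  have "b \<bullet> v = (\<Sum>i\<in>I. (b \<bullet> coroot (\<alpha> i)) * (\<omega> i \<bullet> v))"
    by (subst weight_expansion[OF b]) (simp add: inner_sum_left)
  then show "b \<bullet> v = b \<bullet> (\<Sum>i\<in>I. (v \<bullet> \<omega> i) *\<^sub>R coroot (\<alpha> i))"
    by (simp add: inner_sum_right mult.commute inner_commute)
qed

section \<open>Positive roots and the exchange property\<close>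

text \<open>For a root, the pairing with \<open>\<omega> i\<close> is a positive multiple of its
  coefficient at \<open>\<alpha> i\<close>, so this is the usual positivity.\<close>

definition positive :: "real^'n \<Rightarrow> bool" where
  "positive b \<longleftrightarrow> (\<forall>i\<in>I. 0 \<le> b \<bullet> \<omega> i)"

lemma root_sign:
  assumes "b \<in> \<Phi>"
  shows "positive b \<or> positive (- b)"
proof -
  obtain c :: "'i \<Rightarrow> int" where c: "b = (\<Sum>i\<in>I. of_int (c i) *\<^sub>R \<alpha> i)"
      "(\<forall>i\<in>I. 0 \<le> c i) \<or> (\<forall>i\<in>I. c i \<le> 0)"
    using assms simple_roots by (auto simp: simple_roots_def)
  have "(0 \<le> c i \<longrightarrow> 0 \<le> b \<bullet> \<omega> i) \<and> (c i \<le> 0 \<longrightarrow> b \<bullet> \<omega> i \<le> 0)" if "i \<in> I" for i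
  proof -
    have "b \<bullet> \<omega> i = (\<Sum>j\<in>I. if j = i then of_int (c i) * ((\<alpha> i \<bullet> \<alpha> i) / 2) else 0)"
      unfolding c(1) inner_sum_left using that fund_weight_simple by (intro sum.cong) auto
    then have "b \<bullet> \<omega> i = of_int (c i) * ((\<alpha> i \<bullet> \<alpha> i) / 2)" using that finite_index by simp
    then show ?thesis by (simp only:) (simp add: mult_nonneg_nonneg mult_nonpos_nonneg)
  qed
  then show ?thesis using c(2) by (auto simp: positive_def)
qed

lemma not_both_signs:
  assumes "b \<in> \<Phi>" "positive b"
  shows "\<not> positive (- b)"
proof
  assume "positive (- b)"
  then have "\<forall>i\<in>I. b \<bullet> \<omega> i = 0" using assms(2) by (force simp: positive_def)
  then have "b = 0" using coroot_expansion[OF root_in_span[OF assms(1)]] by simp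
  then show False using assms zero_not_root by simp
qed

lemma positive_simple: "i \<in> I \<Longrightarrow> positive (\<alpha> i)"
  using fund_weight_simple by (auto simp: positive_def)

text \<open>Only the coefficient at \<open>\<alpha> j\<close> changes. Some other coefficient of
  \<open>b\<close> is positive, and a root with one positive coefficient is a positive root.\<close>

lemma simple_reflection_positive:
  assumes b: "b \<in> \<Phi>" "positive b" and j: "j \<in> I" "b \<noteq> \<alpha> j"
  shows "positive (reflection (\<alpha> j) b)"
proof -
  have "\<exists>i\<in>I. i \<noteq> j \<and> b \<bullet> \<omega> i \<noteq> 0"
  proof (rule ccontr)
    assume "\<not> ?thesis"
    then have "(b \<bullet> \<omega> i) *\<^sub>R coroot (\<alpha> i) = (if i = j then (b \<bullet> \<omega> j) *\<^sub>R coroot (\<alpha> j) else 0)" if "i \<in> I" for i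
      using that by auto
    then have "b = (\<Sum>i\<in>I. if i = j then (b \<bullet> \<omega> j) *\<^sub>R coroot (\<alpha> j) else 0)"
      by (subst coroot_expansion[OF root_in_span[OF b(1)]]) (rule sum.cong, auto)
    then have eq: "b = (b \<bullet> \<omega> j) *\<^sub>R coroot (\<alpha> j)" using finite_index j(1) by simp
    then have "((b \<bullet> \<omega> j) * (2 / (\<alpha> j \<bullet> \<alpha> j))) *\<^sub>R \<alpha> j = b" by (simp add: coroot_def)
    \<comment> \<open>The root system is reduced: a multiple of a root that is again a root is the
      root or its negative.\<close>
    then have "b = \<alpha> j \<or> b = - \<alpha> j"
      using b(1) simple_root[OF j(1)] root_system unfolding root_system_def
      by (metis scaleR_minus1_left scaleR_one)
    then show False
      using j b not_both_signs positive_simple simple_root by blast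
  qed
  then obtain i where i: "i \<in> I" "i \<noteq> j" "0 < b \<bullet> \<omega> i"
    using b(2) by (force simp: positive_def)
  have root: "reflection (\<alpha> j) b \<in> \<Phi>"
    using weyl_root[OF root_system weyl_reflection] simple_root j b by blast
  have "reflection (\<alpha> j) b \<bullet> \<omega> i = b \<bullet> \<omega> i"
    using i j(1) by (simp add: reflection_inner inner_commute[of "\<omega> i"] fund_weight_simple)
  then have "\<not> positive (- reflection (\<alpha> j) b)"
    using i by (auto simp: positive_def not_le intro: bexI[of _ i])
  then show ?thesis using root_sign[OF root] by simp
qed

section \<open>Words in the simple reflections\<close>

fun word :: "'i list \<Rightarrow> real^'n \<Rightarrow> real^'n" where
  "word [] = id"
| "word (i # u) = reflection (\<alpha> i) \<circ> word u"

lemma word_append: "word (u @ v) = word u \<circ> word v"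
  by (induction u) (auto simp: comp_assoc)

lemma word_in_weyl: "set u \<subseteq> I \<Longrightarrow> word u \<in> W"
  by (induction u) (auto intro: weyl_id weyl_step simple_root)

text \<open>In a counterexample among the positive roots with least pairing with
  \<open>\<rho>\<close>, some simple reflection yields a positive root of smaller pairing;
  conjugating the word for that root gives one for \<open>b\<close>.\<close>

lemma reflection_is_word:
  assumes "b \<in> \<Phi>"
  shows "\<exists>u. set u \<subseteq> I \<and> reflection b = word u"
proof -
  have refl_minus: "reflection (- c) = reflection c" for c :: "real^'n"
    by (auto simp: reflection_def coroot_def)
  let ?bad = "{b \<in> \<Phi>. positive b \<and> (\<nexists>u. set u \<subseteq> I \<and> reflection b = word u)}"
  have "?bad = {}"
  proof (rule ccontr)
    assume "?bad \<noteq> {}"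
    moreover have "finite ?bad" using finite_roots by simp
    ultimately obtain b where b: "b \<in> ?bad" "\<And>c. c \<in> ?bad \<Longrightarrow> b \<bullet> \<rho> \<le> c \<bullet> \<rho>"
      using arg_min_if_finite(1)[of ?bad "\<lambda>b. b \<bullet> \<rho>"] arg_min_least[of ?bad _ "\<lambda>b. b \<bullet> \<rho>"] by blast
    \<comment> \<open>A positive sum has a positive summand; this selects the simple root to reflect
      in.\<close>
    have "b \<bullet> b = (\<Sum>i\<in>I. (b \<bullet> \<omega> i) * (coroot (\<alpha> i) \<bullet> b))"
      using b(1) by (subst coroot_expansion[OF root_in_span, of b]) (auto simp: inner_sum_left)
    moreover have "b \<bullet> b > 0" using b(1) zero_not_root by auto
    ultimately obtain i where i: "i \<in> I" "0 < (b \<bullet> \<omega> i) * (coroot (\<alpha> i) \<bullet> b)"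
      by (metis (no_types, lifting) linorder_not_less sum_nonpos)
    moreover have "0 \<le> b \<bullet> \<omega> i" using b(1) i(1) by (auto simp: positive_def)
    ultimately have pos: "0 < b \<bullet> coroot (\<alpha> i)"
      by (simp add: zero_less_mult_iff inner_commute)
    let ?c = "reflection (\<alpha> i) b"
    have "b \<noteq> \<alpha> i"
    proof
      assume "b = \<alpha> i"
      then have "set [i] \<subseteq> I \<and> reflection b = word [i]" using i by simp
      then show False using b(1) by blast
    qed
    then have "positive ?c" using simple_reflection_positive b(1) i by blast
    moreover have "?c \<in> \<Phi>"
      using weyl_root[OF root_system weyl_reflection] simple_root i b by blast
    moreover have "?c \<bullet> \<rho> < b \<bullet> \<rho>"
      using pos rho_simple_pos[OF i(1)] by (simp add: reflection_inner)
    ultimately have "?c \<notin> ?bad" using b(2) by force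
    then obtain u where u: "set u \<subseteq> I" "reflection ?c = word u"
      using \<open>positive ?c\<close> \<open>?c \<in> \<Phi>\<close> by blast
    have "reflection (\<alpha> i) (reflection b x) = reflection ?c (reflection (\<alpha> i) x)" for x
      by (rule reflection_conjugate[OF linear_reflection inner_reflection])
    then have "reflection b x = reflection (\<alpha> i) (reflection ?c (reflection (\<alpha> i) x))" for x
      by (metis reflection_reflection)
    then have "reflection b = word ([i] @ u @ [i])"
      by (auto simp: word_append u(2)[symmetric])
    moreover have "set ([i] @ u @ [i]) \<subseteq> I" using u i by simp
    ultimately show False using b(1) by blast
  qed
  then have *: "\<exists>u. set u \<subseteq> I \<and> reflection c = word u" if "c \<in> \<Phi>" "positive c" for c
    using that by blast
  have "positive b \<or> positive (- b)" "- b \<in> \<Phi>"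
    using root_sign assms weyl_root[OF root_system weyl_reflection, of b b] by (auto simp: reflection_self)
  then show ?thesis using assms *[of b] *[of "- b"] by (auto simp: refl_minus)
qed

lemma weyl_is_word: "w \<in> W \<Longrightarrow> \<exists>u. set u \<subseteq> I \<and> w = word u"
proof (induction rule: weyl_group.induct)
  case weyl_id
  show ?case by (rule exI[of _ "[]"]) simp
next
  case (weyl_step w a)
  then obtain u v where "set u \<subseteq> I" "w = word u" "set v \<subseteq> I" "reflection a = word v"
    using reflection_is_word by blast
  then show ?case by (intro exI[of _ "v @ u"]) (simp add: word_append)
qed

text \<open>Followed through the word from right to left, \<open>\<alpha> i\<close> turns negative
  at some letter \<open>j\<close>. Just before, it equals \<open>\<alpha> j\<close>, so composing
  with its reflection amounts to deleting that letter.\<close>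

lemma exchange:
  assumes "set u \<subseteq> I" "i \<in> I" "\<not> positive (word u (\<alpha> i))"
  shows "\<exists>v. set v \<subseteq> I \<and> length v < length u \<and> word v = word u \<circ> reflection (\<alpha> i)"
  using assms
proof (induction u)
  case (Cons j u)
  show ?case
  proof (cases "positive (word u (\<alpha> i))")
    case True
    have root: "word u (\<alpha> i) \<in> \<Phi>"
      using Cons.prems weyl_root[OF root_system word_in_weyl simple_root] by simp
    \<comment> \<open>The only positive root that the reflection in \<open>\<alpha> j\<close> makes
      non-positive is \<open>\<alpha> j\<close> itself.\<close>
    then have eq: "word u (\<alpha> i) = \<alpha> j"
      using simple_reflection_positive[OF root True] Cons.prems by auto
    have "word u (reflection (\<alpha> i) x) = reflection (\<alpha> j) (word u x)" for x
    proof -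
      have wu: "word u \<in> W" using Cons.prems word_in_weyl by simp
      show ?thesis
        using reflection_conjugate[OF weyl_linear[OF wu] weyl_inner[OF wu]] by (simp add: eq)
    qed
    then have "word (j # u) \<circ> reflection (\<alpha> i) = word u" by (intro ext) simp
    from this[symmetric] show ?thesis
      using Cons.prems by (intro exI[of _ u] conjI) (assumption | simp)+
  next
    case False
    have "set u \<subseteq> I" using Cons.prems by simp
    from Cons.IH[OF this Cons.prems(2) False] obtain v where
      v: "set v \<subseteq> I" "length v < length u" "word v = word u \<circ> reflection (\<alpha> i)" by blast
    have "word (j # v) = word (j # u) \<circ> reflection (\<alpha> i)"
      by (simp only: word.simps v(3) comp_assoc)
    moreover have "set (j # v) \<subseteq> I" "length (j # v) < length (j # u)"
      using v Cons.prems by simp_all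
    ultimately show ?thesis by blast
  qed
qed (simp add: positive_simple)

section \<open>The fundamental chamber and its role for orbits\<close>

definition chamber :: "(real^'n) set" where
  "chamber = {x. \<forall>i\<in>I. 0 \<le> x \<bullet> \<alpha> i}"

lemma chamber_positive_root:
  assumes "x \<in> chamber" "b \<in> \<Phi>" "positive b"
  shows "0 \<le> x \<bullet> b"
proof -
  have "0 \<le> x \<bullet> coroot (\<alpha> i)" if "i \<in> I" for i
    using that assms(1) coroot_inner_nonneg_iff simple_nonzero by (auto simp: chamber_def)
  then have "0 \<le> (\<Sum>i\<in>I. (b \<bullet> \<omega> i) * (x \<bullet> coroot (\<alpha> i)))"
    using assms(3) by (intro sum_nonneg mult_nonneg_nonneg) (auto simp: positive_def)
  also have "\<dots> = x \<bullet> b"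
    by (subst (2) coroot_expansion[OF root_in_span[OF assms(2)]]) (simp add: inner_sum_right)
  finally show ?thesis .
qed

lemma chamber_word:
  assumes "set u \<subseteq> I" "x \<in> chamber" "word u x \<in> chamber"
  shows "word u x = x \<and> ((\<forall>i\<in>I. 0 < x \<bullet> \<alpha> i) \<longrightarrow> word u = id)"
  using assms
proof (induction "length u" arbitrary: u rule: less_induct)
  case less
  show ?case
  proof (cases u rule: rev_cases)
    case (snoc v i)
    then have v: "set v \<subseteq> I" and i: "i \<in> I" using less.prems by auto
    show ?thesis
    proof (cases "positive (word v (\<alpha> i))")
      case True
      have wv: "word v \<in> W" using v word_in_weyl by simp
      have "0 \<le> word u x \<bullet> word v (\<alpha> i)"
        using chamber_positive_root less.prems True weyl_root[OF root_system wv] simple_root i by blast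
      also have "\<dots> = reflection (\<alpha> i) x \<bullet> \<alpha> i"
        using snoc by (simp add: word_append weyl_inner[OF wv])
      also have "\<dots> = - (x \<bullet> \<alpha> i)"
        by (simp add: inner_reflection_left reflection_self)
      finally have x: "x \<bullet> \<alpha> i = 0" using less.prems i by (force simp: chamber_def)
      then have "reflection (\<alpha> i) x = x" by (simp add: reflection_def coroot_def)
      then have "word u x = word v x" using snoc by (simp add: word_append)
      then have "word u x = x" using less.hyps[of v] less.prems v snoc by simp
      then show ?thesis using x i by force
    next
      case False
      from exchange[OF v i this] obtain u' where
        "set u' \<subseteq> I" "length u' < length v" "word u' = word v \<circ> reflection (\<alpha> i)" by blast
      then have "set u' \<subseteq> I" "length u' < length u" "word u' = word u"
        using snoc by (auto simp: word_append)
      then show ?thesis using less.hyps[of u'] less.prems by simp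
    qed
  qed simp
qed

lemma chamber_orbit_unique: "w \<in> W \<Longrightarrow> x \<in> chamber \<Longrightarrow> w x \<in> chamber \<Longrightarrow> w x = x"
  using chamber_word weyl_is_word by blast

lemma rho_chamber: "\<rho> \<in> chamber"
  using rho_simple_pos by (simp add: chamber_def less_imp_le)

lemma rho_stabilizer: "w \<in> W \<Longrightarrow> w \<rho> = \<rho> \<Longrightarrow> w = id"
  using chamber_word weyl_is_word rho_chamber rho_simple_pos by metis

lemma finite_weyl: "finite W"
  by (rule finite_weyl_group[OF root_system])

text \<open>Were a pairing with a simple coroot negative, the reflection would raise the pairing
  with \<open>\<rho>\<close>. Hence maximizing over an orbit finds a point of the chamber.\<close>

lemma rho_maximal_in_chamber:
  assumes "\<And>i. i \<in> I \<Longrightarrow> reflection (\<alpha> i) y \<bullet> \<rho> \<le> y \<bullet> \<rho>"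
  shows "y \<in> chamber"
  unfolding chamber_def
proof (intro CollectI ballI, rule ccontr)
  fix i assume i: "i \<in> I" and "\<not> 0 \<le> y \<bullet> \<alpha> i"
  then have "y \<bullet> coroot (\<alpha> i) < 0"
    using coroot_inner_nonneg_iff simple_nonzero by (metis not_le)
  then have "y \<bullet> \<rho> < reflection (\<alpha> i) y \<bullet> \<rho>"
    using rho_simple_pos[OF i] by (simp add: reflection_inner mult_neg_pos)
  then show False using assms[OF i] by simp
qed

definition orbit :: "real^'n \<Rightarrow> (real^'n) set" where
  "orbit x = (\<lambda>w. w x) ` W"

lemma finite_orbit: "finite (orbit x)"
  by (simp add: orbit_def finite_weyl)

lemma orbit_self: "x \<in> orbit x"
  unfolding orbit_def by (rule image_eqI[OF _ weyl_id]) simp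

lemma orbit_closed:
  assumes "y \<in> orbit x" "w \<in> W"
  shows "w y \<in> orbit x"
proof -
  obtain v where v: "v \<in> W" "y = v x" using assms(1) by (auto simp: orbit_def)
  show ?thesis unfolding orbit_def
    by (rule image_eqI[OF _ weyl_comp[OF assms(2) v(1)]]) (simp add: v(2))
qed

lemma orbit_maximum: "\<exists>y\<in>orbit x. \<forall>z\<in>orbit x. z \<bullet> \<rho> \<le> y \<bullet> \<rho>"
proof -
  let ?V = "(\<lambda>y. y \<bullet> \<rho>) ` orbit x"
  have "finite ?V" "?V \<noteq> {}" using finite_orbit orbit_self by auto
  from imageE[OF Max_in[OF this]] obtain y where "Max ?V = y \<bullet> \<rho>" "y \<in> orbit x" .
  moreover have "z \<bullet> \<rho> \<le> Max ?V" if "z \<in> orbit x" for z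
    using \<open>finite ?V\<close> that by (simp add: Max_ge)
  ultimately show ?thesis by (intro bexI[of _ y]) simp_all
qed

lemma orbit_maximum_in_chamber:
  assumes "y \<in> orbit x" "\<forall>z\<in>orbit x. z \<bullet> \<rho> \<le> y \<bullet> \<rho>"
  shows "y \<in> chamber"
  using assms orbit_closed weyl_reflection simple_root by (intro rho_maximal_in_chamber) blast

lemma orbit_meets_chamber: "\<exists>w\<in>W. w x \<in> chamber"
  using orbit_maximum[of x] orbit_maximum_in_chamber[of _ x] unfolding orbit_def by auto

text \<open>A maximizer lies in the chamber, which holds only one point of the orbit. Strictness
  makes norms drop in the construction of bialternants.\<close>

lemma chamber_maximizes_rho:
  assumes "x \<in> chamber" "y \<in> orbit x" "y \<noteq> x"
  shows "y \<bullet> \<rho> < x \<bullet> \<rho>"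
proof -
  have unique: "z = x" if "z \<in> orbit x" "z \<in> chamber" for z
    using that chamber_orbit_unique assms(1) by (auto simp: orbit_def)
  then have max: "\<forall>z\<in>orbit x. z \<bullet> \<rho> \<le> x \<bullet> \<rho>"
    using orbit_maximum[of x] orbit_maximum_in_chamber[of _ x] by metis
  moreover have "y \<bullet> \<rho> \<noteq> x \<bullet> \<rho>"
    using max assms orbit_maximum_in_chamber unique by metis
  ultimately show ?thesis using assms(2) by force
qed

end

section \<open>The group ring\<close>

lemma expo_add: "expo \<mu> * expo \<nu> = expo (\<mu> + \<nu>)"
  by (simp add: expo_def mult_single)

lemma lookup_of_int_mult:
  "Poly_Mapping.lookup (of_int c * f) x = c * Poly_Mapping.lookup f (x :: 'a :: monoid_add)"
  by (simp add: lookup_mult lookup_single when_mult flip: single_of_int)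

lemma lookup_expo_mult:
  "Poly_Mapping.lookup (expo \<mu> * f) x = Poly_Mapping.lookup f (x - \<mu>)"
proof -
  have eq: "x = \<mu> + q \<longleftrightarrow> q = x - \<mu>" for q by auto
  show ?thesis
    by (simp only: lookup_mult expo_def lookup_single when_mult mult_1_left eq
        Sum_any_when_equal Sum_any_when_equal')
qed

lemma weyl_act_superset:
  assumes "finite F" "Poly_Mapping.keys f \<subseteq> F"
  shows "weyl_act w f = (\<Sum>\<mu>\<in>F. of_int (Poly_Mapping.lookup f \<mu>) * expo (w \<mu>))"
  unfolding weyl_act_def using assms
  by (intro sum.mono_neutral_left) (auto simp: in_keys_iff)

lemma weyl_act_add: "weyl_act w (f + g) = weyl_act w f + weyl_act w g"
proof -
  \<comment> \<open>Cancellation may remove keys from \<open>f + g\<close>, so all three sums run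
    over one common finite set.\<close>
  let ?F = "Poly_Mapping.keys f \<union> Poly_Mapping.keys g"
  have "finite ?F" "Poly_Mapping.keys (f + g) \<subseteq> ?F"
    by (simp_all add: keys_add)
  then show ?thesis
    by (simp add: weyl_act_superset[of ?F] lookup_add distrib_right sum.distrib)
qed

lemma weyl_act_expo: "weyl_act w (expo \<mu>) = expo (w \<mu>)"
  by (simp add: weyl_act_def expo_def)

lemma weyl_act_sum_expo: "weyl_act w (\<Sum>x\<in>X. expo (g x)) = (\<Sum>x\<in>X. expo (w (g x)))"
  by (induction X rule: infinite_finite_induct) (simp_all add: weyl_act_add weyl_act_expo, simp_all add: weyl_act_def)

text \<open>In the summand of \<open>w\<close> the invariant factor may be replaced by its image
  under \<open>w\<close>, so exponents combine to \<open>w (\<nu> + g x)\<close>; exchanging the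
  sums leaves alternants.\<close>

lemma alternant_mult_invariant:
  assumes "weyl_invariant \<Phi> (\<Sum>x\<in>X. expo (g x))"
  shows "alternant \<Phi> \<nu> * (\<Sum>x\<in>X. expo (g x)) = (\<Sum>x\<in>X. alternant \<Phi> (\<nu> + g x))"
proof -
  let ?f = "\<Sum>x\<in>X. expo (g x)"
  have "expo (w \<nu>) * ?f = (\<Sum>x\<in>X. expo (w (\<nu> + g x)))" if w: "w \<in> weyl_group \<Phi>" for w
  proof -
    have "expo (w \<nu>) * ?f = expo (w \<nu>) * weyl_act w ?f"
      using assms w by (simp add: weyl_invariant_def)
    then show ?thesis
      by (simp add: weyl_act_sum_expo sum_distrib_left expo_add linear_add[OF weyl_linear[OF w]])
  qed
  then have "alternant \<Phi> \<nu> * ?f =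
      (\<Sum>w\<in>weyl_group \<Phi>. \<Sum>x\<in>X. of_int \<lfloor>det (matrix w)\<rfloor> * expo (w (\<nu> + g x)))"
    by (simp add: alternant_def sum_distrib_right mult.assoc flip: sum_distrib_left)
  then show ?thesis
    by (simp add: alternant_def sum.swap[of _ X])
qed

lemma group_ring_zero: "0 \<in> group_ring L"
  by (simp add: group_ring_def)

lemma group_ring_expo: "\<mu> \<in> L \<Longrightarrow> expo \<mu> \<in> group_ring L"
  by (simp add: group_ring_def expo_def)

lemma group_ring_add: "f \<in> group_ring L \<Longrightarrow> g \<in> group_ring L \<Longrightarrow> f + g \<in> group_ring L"
  using keys_add[of f g] by (auto simp: group_ring_def)

lemma group_ring_uminus: "f \<in> group_ring L \<Longrightarrow> - f \<in> group_ring L"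
  by (auto simp: group_ring_def in_keys_iff)

lemma group_ring_diff: "f \<in> group_ring L \<Longrightarrow> g \<in> group_ring L \<Longrightarrow> f - g \<in> group_ring L"
  using group_ring_add[OF _ group_ring_uminus, of f L g] by simp

lemma group_ring_sum: "(\<And>x. x \<in> X \<Longrightarrow> f x \<in> group_ring L) \<Longrightarrow> (\<Sum>x\<in>X. f x) \<in> group_ring L"
  by (induction X rule: infinite_finite_induct) (auto intro: group_ring_zero group_ring_add)

section \<open>Existence and uniqueness of bialternants\<close>

context based_root_system
begin

text \<open>The leading term \<open>e\<^sup>\<rho>\<close> of \<open>A \<rho>\<close> with respect to the functional \<open>(\<bullet>) \<rho>\<close> cannot cancel against
  a leading term of \<open>f\<close>.\<close>

lemma alternant_rho_mult_eq_zero: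
  assumes "A \<rho> * f = 0"
  shows "f = 0"
proof (rule ccontr)
  assume "f \<noteq> 0"
  let ?V = "(\<lambda>x. x \<bullet> \<rho>) ` Poly_Mapping.keys f"
  have "finite ?V" "?V \<noteq> {}" using \<open>f \<noteq> 0\<close> by auto
  from imageE[OF Max_in[OF this]] obtain \<mu> where \<mu>: "Max ?V = \<mu> \<bullet> \<rho>" "\<mu> \<in> Poly_Mapping.keys f" .
  have above: "Poly_Mapping.lookup f x = 0" if "\<mu> \<bullet> \<rho> < x \<bullet> \<rho>" for x
  proof (rule ccontr)
    assume "Poly_Mapping.lookup f x \<noteq> 0"
    then have "x \<bullet> \<rho> \<in> ?V" by (simp add: in_keys_iff)
    then have "x \<bullet> \<rho> \<le> Max ?V" using \<open>finite ?V\<close> by (rule Max_ge[rotated])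
    then show False using that \<mu>(1) by simp
  qed
  have "Poly_Mapping.lookup f (\<rho> + \<mu> - w \<rho>) = 0" if w: "w \<in> W" "w \<noteq> id" for w
  proof (rule above)
    have "w \<rho> \<noteq> \<rho>" using w rho_stabilizer by blast
    \<comment> \<open>As \<open>w \<rho>\<close> and \<open>\<rho>\<close> have equal norm, a
      positive squared distance means
      \<open>w \<rho> \<bullet> \<rho> < \<rho> \<bullet> \<rho>\<close>.\<close>
    then have "0 < (w \<rho> - \<rho>) \<bullet> (w \<rho> - \<rho>)" by simp
    then have "w \<rho> \<bullet> \<rho> < \<rho> \<bullet> \<rho>"
      using weyl_inner[OF w(1), of \<rho> \<rho>] by (simp add: algebra_simps inner_commute del: inner_gt_zero_iff)
    then show "\<mu> \<bullet> \<rho> < (\<rho> + \<mu> - w \<rho>) \<bullet> \<rho>" by (simp add: algebra_simps)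
  qed
  \<comment> \<open>At the exponent \<open>\<rho> + \<mu>\<close> only the identity, of determinant
    1, contributes.\<close>
  then have "Poly_Mapping.lookup (A \<rho> * f) (\<rho> + \<mu>) =
      (\<Sum>w\<in>W. if w = id then Poly_Mapping.lookup f \<mu> else 0)"
    by (auto simp: alternant_def sum_distrib_right lookup_sum mult.assoc lookup_of_int_mult lookup_expo_mult
        matrix_id_mat_1 intro!: sum.cong)
  then have "Poly_Mapping.lookup (A \<rho> * f) (\<rho> + \<mu>) = Poly_Mapping.lookup f \<mu>"
    using finite_weyl weyl_id[of \<Phi>] by simp
  then show False using assms \<mu>(2) by (simp add: in_keys_iff)
qed

lemma alternant_rho_cancel: "A \<rho> * f = A \<rho> * g \<Longrightarrow> f = g"
  using alternant_rho_mult_eq_zero[of "f - g"] by (simp add: algebra_simps)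

lemma weight_lattice_add: "x \<in> weight_lattice I \<alpha> \<Longrightarrow> y \<in> weight_lattice I \<alpha> \<Longrightarrow> x + y \<in> weight_lattice I \<alpha>"
  by (auto simp: weight_lattice_iff inner_add_left intro: span_add)

lemma weight_lattice_diff: "x \<in> weight_lattice I \<alpha> \<Longrightarrow> y \<in> weight_lattice I \<alpha> \<Longrightarrow> x - y \<in> weight_lattice I \<alpha>"
  by (auto simp: weight_lattice_iff inner_diff_left intro: span_diff)

lemma rho_weight: "\<rho> \<in> weight_lattice I \<alpha>"
  by (simp add: weight_lattice_iff rho_in_span rho_coroot)

lemma reflection_weight:
  assumes "x \<in> weight_lattice I \<alpha>" "i \<in> I"
  shows "reflection (\<alpha> i) x \<in> weight_lattice I \<alpha>"
  unfolding weight_lattice_iff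
proof (intro conjI ballI)
  show "reflection (\<alpha> i) x \<in> span (\<alpha> ` I)"
    using assms by (auto simp: reflection_def weight_lattice_iff intro: span_diff span_scale span_base)
  fix j assume j: "j \<in> I"
  show "reflection (\<alpha> i) x \<bullet> coroot (\<alpha> j) \<in> \<int>"
    using assms j inner_coroot_int simple_root
    by (auto simp: reflection_def inner_diff_left weight_lattice_iff)
qed

lemma weyl_weight:
  assumes "w \<in> W" "x \<in> weight_lattice I \<alpha>"
  shows "w x \<in> weight_lattice I \<alpha>"
proof -
  have "word u x \<in> weight_lattice I \<alpha>" if "set u \<subseteq> I" for u
    using that by (induction u) (auto simp: assms(2) reflection_weight)
  then show ?thesis using weyl_is_word[OF assms(1)] by blast
qed

text \<open>Coroot pairings identify weights with integer vectors, and Cauchy-Schwarz bounds each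
  coordinate.\<close>

lemma finite_bounded_weights: "finite {x \<in> weight_lattice I \<alpha>. norm x \<le> B}"
proof -
  let ?X = "{x \<in> weight_lattice I \<alpha>. norm x \<le> B}"
  let ?g = "\<lambda>x. restrict (\<lambda>i. x \<bullet> coroot (\<alpha> i)) I"
  let ?T = "PiE I (\<lambda>i. {k \<in> \<int>. \<bar>k\<bar> \<le> B * norm (coroot (\<alpha> i))})"
  have "x \<bullet> coroot (\<alpha> i) \<in> {k \<in> \<int>. \<bar>k\<bar> \<le> B * norm (coroot (\<alpha> i))}" if "x \<in> ?X" "i \<in> I" for x i
  proof -
    have "\<bar>x \<bullet> coroot (\<alpha> i)\<bar> \<le> norm x * norm (coroot (\<alpha> i))" by (rule Cauchy_Schwarz_ineq2)
    also have "\<dots> \<le> B * norm (coroot (\<alpha> i))" using that by (intro mult_right_mono) auto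
    finally show ?thesis using that by (auto simp: weight_lattice_iff)
  qed
  then have "?g ` ?X \<subseteq> ?T" by (auto simp: PiE_iff)
  moreover have "finite ?T" by (intro finite_PiE finite_index finite_abs_int_segment)
  moreover have "inj_on ?g ?X"
  proof (rule inj_onI)
    fix x y assume xy: "x \<in> ?X" "y \<in> ?X" "?g x = ?g y"
    show "x = y"
    proof (rule span_eqI)
      fix i assume "i \<in> I"
      then show "x \<bullet> coroot (\<alpha> i) = y \<bullet> coroot (\<alpha> i)" using fun_cong[OF xy(3), of i] by simp
    qed (use xy in \<open>auto simp: weight_lattice_iff\<close>)
  qed
  ultimately show ?thesis by (meson finite_imageD finite_subset)
qed

lemma orbit_sum_invariant: "weyl_invariant \<Phi> (\<Sum>\<nu>\<in>orbit x. expo \<nu>)"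
  unfolding weyl_invariant_def
proof
  fix w assume w: "w \<in> W"
  have "inj_on w (orbit x)"
    using weyl_inj[OF w] by (rule inj_on_subset) simp
  moreover from this have "w ` orbit x = orbit x"
    using w orbit_closed by (intro card_subset_eq finite_orbit) (auto simp: card_image)
  ultimately have "bij_betw w (orbit x) (orbit x)"
    by (simp add: bij_betw_def)
  then have "(\<Sum>\<nu>\<in>orbit x. expo (w \<nu>)) = (\<Sum>\<nu>\<in>orbit x. expo \<nu>)"
    by (rule sum.reindex_bij_betw)
  then show "weyl_act w (\<Sum>\<nu>\<in>orbit x. expo \<nu>) = (\<Sum>\<nu>\<in>orbit x. expo \<nu>)"
    using weyl_act_sum_expo[of w "\<lambda>\<nu>. \<nu>"] by simp
qed

text \<open>Triangularity: multiplying \<open>A \<rho>\<close> by the orbit sum of \<open>\<lambda>\<close> yields \<open>A (\<lambda> + \<rho>)\<close> plus alternants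
  that vanish or are, up to sign, of the form \<open>A (\<mu> + \<rho>)\<close> with \<open>\<mu>\<close> dominant and
  \<open>norm (\<mu> + \<rho>) < norm (\<lambda> + \<rho>)\<close>.\<close>

lemma bialternant_exists:
  assumes "l \<in> dominant_weights I \<alpha>"
  shows "\<exists>f\<in>group_ring (weight_lattice I \<alpha>). A \<rho> * f = A (l + \<rho>)"
  using assms
\<comment> \<open>Norms are real, so the induction runs over the number of dominant weights of
  smaller shifted norm.\<close>
proof (induction "card {m \<in> dominant_weights I \<alpha>. norm (m + \<rho>) < norm (l + \<rho>)}" arbitrary: l rule: less_induct)
  case less
  let ?below = "\<lambda>l. {m \<in> dominant_weights I \<alpha>. norm (m + \<rho>) < norm (l + \<rho>)}"
  let ?G = "group_ring (weight_lattice I \<alpha>)"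
  have finite_below: "finite (?below x)" for x
  proof (rule finite_subset)
    have "norm m \<le> norm (x + \<rho>) + norm \<rho>" if "norm (m + \<rho>) < norm (x + \<rho>)" for m
      using that norm_triangle_ineq4[of "m + \<rho>" \<rho>] by simp
    then show "?below x \<subseteq> {m \<in> weight_lattice I \<alpha>. norm m \<le> norm (x + \<rho>) + norm \<rho>}"
      by (auto simp: dominant_weights_iff)
  qed (rule finite_bounded_weights)
  have IH: "\<exists>f\<in>?G. A \<rho> * f = A (m + \<rho>)" if "m \<in> dominant_weights I \<alpha>" "norm (m + \<rho>) < norm (l + \<rho>)" for m
  proof (rule less.hyps[OF _ that(1)])
    have "?below m \<subset> ?below l" using that by auto
    then show "card (?below m) < card (?below l)" using finite_below by (intro psubset_card_mono)
  qed
  have l: "l \<in> weight_lattice I \<alpha>" "l \<in> chamber"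
    using less.prems by (auto simp: dominant_weights_iff chamber_def)
  have step: "\<exists>f\<in>?G. A \<rho> * f = A (\<rho> + \<nu>)" if \<nu>: "\<nu> \<in> orbit l" "\<nu> \<noteq> l" for \<nu>
  proof -
    \<comment> \<open>Moving \<open>\<rho> + \<nu>\<close> into the chamber changes its alternant at
      most by a sign.\<close>
    obtain w where w: "w \<in> W" "w (\<rho> + \<nu>) \<in> chamber" using orbit_meets_chamber by blast
    define \<eta> where "\<eta> = w (\<rho> + \<nu>)"
    have \<eta>_alt: "A \<eta> = A (\<rho> + \<nu>) \<or> A \<eta> = - A (\<rho> + \<nu>)"
      unfolding \<eta>_def by (rule alternant_weyl[OF zero_not_root w(1)])
    have "\<exists>f\<in>?G. A \<rho> * f = A \<eta>"
    proof (cases "\<exists>i\<in>I. \<eta> \<bullet> \<alpha> i = 0")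
      case True
      then have "A \<eta> = 0" using alternant_wall simple_root simple_nonzero by blast
      then show ?thesis using group_ring_zero by (intro bexI[of _ 0]) simp_all
    next
      case False
      have "\<nu> \<in> weight_lattice I \<alpha>" using \<nu>(1) l(1) weyl_weight by (auto simp: orbit_def)
      then have \<eta>_weight: "\<eta> \<in> weight_lattice I \<alpha>"
        unfolding \<eta>_def by (rule weyl_weight[OF w(1) weight_lattice_add[OF rho_weight]])
      have "0 \<le> (\<eta> - \<rho>) \<bullet> \<alpha> i" if i: "i \<in> I" for i
      proof -
        have "0 < \<eta> \<bullet> \<alpha> i" using False i w(2) by (force simp: chamber_def \<eta>_def)
        \<comment> \<open>A positive integer is at least 1, which is the pairing of
          \<open>\<rho>\<close>, so subtracting \<open>\<rho>\<close> leaves a nonnegative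
          value.\<close>
        then have "0 < \<eta> \<bullet> coroot (\<alpha> i)" "\<eta> \<bullet> coroot (\<alpha> i) \<in> \<int>"
          using i \<eta>_weight coroot_inner_pos_iff simple_nonzero by (auto simp: weight_lattice_iff)
        then have "0 \<le> (\<eta> - \<rho>) \<bullet> coroot (\<alpha> i)"
          using i by (auto simp: inner_diff_left rho_coroot elim: Ints_cases)
        then show ?thesis using i coroot_inner_nonneg_iff simple_nonzero by blast
      qed
      then have "\<eta> - \<rho> \<in> dominant_weights I \<alpha>"
        using \<eta>_weight rho_weight weight_lattice_diff by (simp add: dominant_weights_iff)
      moreover have "norm (\<eta> - \<rho> + \<rho>) < norm (l + \<rho>)"
      proof -
        \<comment> \<open>\<open>\<nu>\<close> and \<open>l\<close> have equal norm, so only the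
          cross term with \<open>\<rho>\<close> matters, and it is strictly smaller for
          \<open>\<nu>\<close>.\<close>
        have "\<nu> \<bullet> \<nu> = l \<bullet> l" using \<nu>(1) weyl_inner by (auto simp: orbit_def)
        moreover have "\<eta> \<bullet> \<eta> = (\<rho> + \<nu>) \<bullet> (\<rho> + \<nu>)" unfolding \<eta>_def by (rule weyl_inner[OF w(1)])
        moreover have "\<nu> \<bullet> \<rho> < l \<bullet> \<rho>" using chamber_maximizes_rho[OF l(2) \<nu>] .
        ultimately have "\<eta> \<bullet> \<eta> < (l + \<rho>) \<bullet> (l + \<rho>)"
          by (simp add: inner_add_left inner_add_right inner_commute)
        then show ?thesis by (simp add: norm_lt)
      qed
      ultimately show ?thesis using IH by fastforce
    qed
    then obtain f where f: "f \<in> ?G" "A \<rho> * f = A \<eta>" by blast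
    from \<eta>_alt show ?thesis
    proof
      assume "A \<eta> = - A (\<rho> + \<nu>)"
      then have "A \<rho> * (- f) = A (\<rho> + \<nu>)" using f(2) by simp
      then show ?thesis using group_ring_uminus[OF f(1)] by blast
    qed (use f in auto)
  qed
  have "\<forall>\<nu>\<in>orbit l - {l}. \<exists>f. f \<in> ?G \<and> A \<rho> * f = A (\<rho> + \<nu>)"
    using step by auto
  then obtain F where F: "\<And>\<nu>. \<nu> \<in> orbit l - {l} \<Longrightarrow> F \<nu> \<in> ?G \<and> A \<rho> * F \<nu> = A (\<rho> + \<nu>)"
    using bchoice[of "orbit l - {l}" "\<lambda>\<nu> f. f \<in> ?G \<and> A \<rho> * f = A (\<rho> + \<nu>)"] by blast
  let ?M = "\<Sum>\<nu>\<in>orbit l. expo \<nu>"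
  have "A \<rho> * ?M = (\<Sum>\<nu>\<in>orbit l. A (\<rho> + \<nu>))"
    using alternant_mult_invariant[of \<Phi> "\<lambda>\<nu>. \<nu>"] orbit_sum_invariant by blast
  also have "\<dots> = A (\<rho> + l) + (\<Sum>\<nu>\<in>orbit l - {l}. A (\<rho> + \<nu>))"
    by (rule sum.remove[OF finite_orbit orbit_self])
  also have "(\<Sum>\<nu>\<in>orbit l - {l}. A (\<rho> + \<nu>)) = A \<rho> * (\<Sum>\<nu>\<in>orbit l - {l}. F \<nu>)"
    unfolding sum_distrib_left using F by (intro sum.cong) auto
  finally have "A \<rho> * (?M - (\<Sum>\<nu>\<in>orbit l - {l}. F \<nu>)) = A (l + \<rho>)"
    by (simp add: right_diff_distrib add.commute)
  moreover have "?M \<in> ?G"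
    using l(1) weyl_weight by (intro group_ring_sum group_ring_expo) (auto simp: orbit_def)
  moreover have "(\<Sum>\<nu>\<in>orbit l - {l}. F \<nu>) \<in> ?G"
    using F by (intro group_ring_sum) blast
  ultimately show ?case using group_ring_diff by blast
qed

text \<open>Existence and cancellation of \<open>A \<rho>\<close> show that the definite description
  in \<open>bialternant\<close> denotes a unique element.\<close>

lemma alternant_mult_bialternant:
  assumes "l \<in> dominant_weights I \<alpha>"
  shows "A \<rho> * bialternant \<Phi> I \<alpha> l = A (l + \<rho>)"
proof -
  let ?P = "\<lambda>f. f \<in> group_ring (weight_lattice I \<alpha>) \<and> A \<rho> * f = A (l + \<rho>)"
  obtain f where f: "?P f" using bialternant_exists[OF assms] by blast
  have "?P (The ?P)"
  proof (rule theI[of ?P f])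
    show "g = f" if "?P g" for g
      by (rule alternant_rho_cancel, rule trans[OF conjunct2[OF that] conjunct2[OF f, symmetric]])
  qed (rule f)
  then show ?thesis by (simp add: bialternant_def)
qed

end

section \<open>Products of chains\<close>

lemma chain_prod_iff: "xs \<in> chain_prod ns \<longleftrightarrow> length xs = length ns \<and> (\<forall>i<length ns. xs ! i < ns ! i)"
  by (auto simp: chain_prod_def list_all2_conv_all_nth)

lemma chain_prod_ord_iff:
  "(xs, ys) \<in> chain_prod_ord ns \<longleftrightarrow>
    xs \<in> chain_prod ns \<and> ys \<in> chain_prod ns \<and> (\<forall>i<length ns. xs ! i \<le> ys ! i)"
  by (auto simp: chain_prod_ord_def list_all2_conv_all_nth chain_prod_iff)

text \<open>An element between the two lists agrees with \<open>xs\<close> off \<open>i\<close>, and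
  at \<open>i\<close> there is no room between consecutive numbers.\<close>

lemma chain_prod_coversI:
  assumes "xs \<in> chain_prod ns" "i < length ns" "Suc (xs ! i) < ns ! i"
  shows "(xs, xs[i := Suc (xs ! i)]) \<in> covers (chain_prod ns) (chain_prod_ord ns)"
proof -
  let ?ys = "xs[i := Suc (xs ! i)]"
  have len: "length xs = length ns" using assms(1) by (simp add: chain_prod_iff)
  have ys: "?ys \<in> chain_prod ns" using assms by (auto simp: chain_prod_iff nth_list_update)
  have "?ys ! i \<noteq> xs ! i" using assms(2) len by simp
  then have "xs \<noteq> ?ys" by metis
  moreover have "(xs, ?ys) \<in> chain_prod_ord ns"
    using assms(1,2) ys len by (auto simp: chain_prod_ord_iff nth_list_update)
  moreover have "u = xs \<or> u = ?ys"
    if u: "u \<in> chain_prod ns" "(xs, u) \<in> chain_prod_ord ns" "(u, ?ys) \<in> chain_prod_ord ns" for u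
  proof -
    have lenu: "length u = length ns" using u(1) by (simp add: chain_prod_iff)
    have between: "xs ! j \<le> u ! j" "u ! j \<le> ?ys ! j" if "j < length ns" for j
      using that u(2,3) by (auto simp: chain_prod_ord_iff)
    have other: "u ! j = xs ! j" if "j < length ns" "j \<noteq> i" for j
      using between[OF that(1)] that by simp
    have "u ! i = xs ! i \<or> u ! i = Suc (xs ! i)"
      using between[OF assms(2)] assms(2) len by auto
    then show ?thesis
    proof
      assume "u ! i = xs ! i"
      then have "u = xs" using other len lenu by (intro nth_equalityI) metis+
      then show ?thesis ..
    next
      assume "u ! i = Suc (xs ! i)"
      then have "u = ?ys" using other len lenu assms(2) by (intro nth_equalityI) (auto simp: nth_list_update)
      then show ?thesis ..
    qed
  qed
  ultimately show ?thesis using assms(1) ys by (auto simp: covers_def)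
qed

lemma sum_list_increment: "i < length xs \<Longrightarrow> sum_list (xs[i := Suc (xs ! i)]) = Suc (sum_list xs)"
  by (simp add: sum_list_update)

text \<open>Raising one entry where the lists differ gives an element above \<open>xs\<close> and
  below \<open>ys\<close>, hence \<open>ys\<close> itself. So \<open>sum_list\<close> has the step
  property of a rank function.\<close>

lemma chain_prod_covers_sum_list:
  assumes "(xs, ys) \<in> covers (chain_prod ns) (chain_prod_ord ns)"
  shows "sum_list ys = Suc (sum_list xs)"
proof -
  have xy: "xs \<in> chain_prod ns" "ys \<in> chain_prod ns" "xs \<noteq> ys" "\<forall>i<length ns. xs ! i \<le> ys ! i"
    using assms by (auto simp: covers_def chain_prod_ord_iff)
  then have len: "length xs = length ns" "length ys = length ns" by (auto simp: chain_prod_iff)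
  then obtain i where i: "i < length ns" "xs ! i \<noteq> ys ! i"
    using xy(3) nth_equalityI by metis
  then have lt: "xs ! i < ys ! i" "ys ! i < ns ! i"
    using xy by (auto simp: chain_prod_iff less_le)
  let ?u = "xs[i := Suc (xs ! i)]"
  have "(xs, ?u) \<in> covers (chain_prod ns) (chain_prod_ord ns)"
    using xy(1) i(1) lt by (intro chain_prod_coversI) auto
  then have u: "(xs, ?u) \<in> chain_prod_ord ns" "?u \<noteq> xs" "?u \<in> chain_prod ns"
    by (auto simp: covers_def)
  moreover have "(?u, ys) \<in> chain_prod_ord ns"
    using u(3) xy len lt i(1) by (auto simp: chain_prod_ord_iff nth_list_update)
  ultimately have "?u = ys" using assms by (auto simp: covers_def)
  then show ?thesis using sum_list_increment[of i xs] i(1) len by simp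
qed

text \<open>Lowering a nonzero entry by one descends a cover, so every element is reached from the
  bottom by covers.\<close>

lemma chain_prod_induct [consumes 1, case_names bottom cover]:
  assumes "xs \<in> chain_prod ns"
    and "P (replicate (length ns) 0)"
    and "\<And>xs ys. (xs, ys) \<in> covers (chain_prod ns) (chain_prod_ord ns) \<Longrightarrow> P xs \<Longrightarrow> P ys"
  shows "P xs"
  using assms(1)
proof (induction "sum_list xs" arbitrary: xs)
  case 0
  then have "xs = replicate (length ns) 0"
    by (intro nth_equalityI) (auto simp: chain_prod_iff)
  then show ?case using assms(2) by simp
next
  case (Suc m)
  have len: "length xs = length ns" using Suc.prems by (simp add: chain_prod_iff)
  have "sum_list xs \<noteq> 0" using Suc.hyps(2) by linarith
  then have "\<exists>n\<in>set xs. n \<noteq> 0" by (simp only: sum_list_eq_0_iff) blast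
  then obtain i where i: "i < length ns" "xs ! i \<noteq> 0"
    unfolding Bex_def in_set_conv_nth len by blast
  define ys where "ys = xs[i := xs ! i - 1]"
  have ys: "ys \<in> chain_prod ns"
    using Suc.prems i(1) by (auto simp: ys_def chain_prod_iff nth_list_update intro: le_less_trans[OF diff_le_self])
  have xs: "xs = ys[i := Suc (ys ! i)]"
    using i len by (simp add: ys_def)
  then have "sum_list xs = Suc (sum_list ys)"
    using sum_list_increment[of i ys] i len by (simp add: ys_def)
  moreover have "(ys, xs) \<in> covers (chain_prod ns) (chain_prod_ord ns)"
    using ys i Suc.prems len by (subst xs, intro chain_prod_coversI) (auto simp: ys_def chain_prod_iff)
  ultimately show ?case using assms(3) Suc.hyps ys by simp
qed

lemma sum_list_chain_prod:
  assumes "chain_sizes ns"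
  shows "sum_list ` chain_prod ns = {0..sum_list ns - length ns}"
  using assms
proof (induction ns)
  case Nil
  show ?case by (simp add: chain_prod_def)
next
  case (Cons n ns)
  then have n: "0 < n" and ns: "chain_sizes ns" by (auto simp: chain_sizes_def)
  \<comment> \<open>All sizes are at least 1, so the truncated subtraction is exact.\<close>
  have len: "length ns \<le> sum_list ns"
    using ns by (induction ns) (auto simp: chain_sizes_def)
  have image: "chain_prod (n # ns) = (\<lambda>(x, xs). x # xs) ` ({0..n - 1} \<times> chain_prod ns)"
    using n by (force simp: chain_prod_def list_all2_Cons2)
  have "sum_list ` chain_prod (n # ns) = (\<lambda>(x, y). x + y) ` ({0..n - 1} \<times> sum_list ` chain_prod ns)"
    unfolding image by (force simp: image_iff)
  also have "\<dots> = (\<lambda>(x, y). x + y) ` ({0..n - 1} \<times> {0..sum_list ns - length ns})"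
    using Cons.IH ns by simp
  also have "\<dots> = {0..sum_list (n # ns) - length (n # ns)}"
  proof (intro equalityI subsetI)
    fix m assume m: "m \<in> {0..sum_list (n # ns) - length (n # ns)}"
    \<comment> \<open>The first chain takes as much of \<open>m\<close> as fits; the rest goes to
      the others.\<close>
    have "m = (\<lambda>(x, y). x + y) (min m (n - 1), m - min m (n - 1))" by simp
    moreover have "(min m (n - 1), m - min m (n - 1)) \<in> {0..n - 1} \<times> {0..sum_list ns - length ns}"
      using m n len by auto
    ultimately show "m \<in> (\<lambda>(x, y). x + y) ` ({0..n - 1} \<times> {0..sum_list ns - length ns})"
      by (rule image_eqI)
  qed (use n len in auto)
  finally show ?case .
qed

section \<open>Reversal of chain products and the shape of sub-faces\<close>

text \<open>The order-reversing involution of the product: \<open>n - 1\<close> is the top of a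
  chain of \<open>n\<close> elements counted from 0.\<close>

definition chain_flip :: "nat list \<Rightarrow> nat list \<Rightarrow> nat list" where
  "chain_flip ns xs = map2 (\<lambda>n x. n - 1 - x) ns xs"

lemma chain_flip_in:
  assumes "xs \<in> chain_prod ns"
  shows "chain_flip ns xs \<in> chain_prod ns"
proof -
  have len: "length xs = length ns" and lt: "\<And>i. i < length ns \<Longrightarrow> xs ! i < ns ! i"
    using assms by (auto simp: chain_prod_iff)
  have "ns ! i - 1 - xs ! i < ns ! i" if "i < length ns" for i
    using lt[OF that] by arith
  then show ?thesis using len by (simp add: chain_prod_iff chain_flip_def)
qed

lemma chain_flip_flip: "xs \<in> chain_prod ns \<Longrightarrow> chain_flip ns (chain_flip ns xs) = xs"
  by (rule nth_equalityI) (auto simp: chain_prod_iff chain_flip_def Suc_diff_Suc less_imp_diff_less)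

lemma sum_list_chain_flip:
  assumes "xs \<in> chain_prod ns"
  shows "sum_list (chain_flip ns xs) + sum_list xs + length ns = sum_list ns"
proof -
  have "list_all2 (<) xs ns" using assms by (simp add: chain_prod_def)
  then show ?thesis
    by (induction rule: list_all2_induct) (auto simp: chain_flip_def)
qed

text \<open>Forbidding the top of one chain shortens it by one element. The bound
  \<open>2 \<le> ns ! q\<close> keeps it nonempty.\<close>

lemma sub_face_eq_chain_prod:
  assumes "\<exists>q<length ns. 2 \<le> ns ! q"
  shows "\<exists>q<length ns. 2 \<le> ns ! q \<and> sub_face ns = chain_prod (ns[q := ns ! q - 1])"
proof -
  let ?Q = "{q. q < length ns \<and> 2 \<le> ns ! q}"
  have "Max ?Q \<in> ?Q" using assms by (intro Max_in) auto
  then have q: "Max ?Q < length ns" "2 \<le> ns ! Max ?Q" by auto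
  have "sub_face ns = {xs \<in> chain_prod ns. xs ! Max ?Q \<noteq> ns ! Max ?Q - 1}"
    using assms by (simp add: sub_face_def Let_def)
  also have "\<dots> = chain_prod (ns[Max ?Q := ns ! Max ?Q - 1])"
  proof (intro equalityI subsetI)
    fix xs assume xs: "xs \<in> {xs \<in> chain_prod ns. xs ! Max ?Q \<noteq> ns ! Max ?Q - 1}"
    then have "xs ! Max ?Q < ns ! Max ?Q" using q by (simp add: chain_prod_iff)
    then have "xs ! Max ?Q < ns ! Max ?Q - 1" using xs by auto
    then show "xs \<in> chain_prod (ns[Max ?Q := ns ! Max ?Q - 1])"
      using xs q(1) by (auto simp: chain_prod_iff nth_list_update)
  next
    fix xs assume xs: "xs \<in> chain_prod (ns[Max ?Q := ns ! Max ?Q - 1])"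
    then have bound: "xs ! i < (ns[Max ?Q := ns ! Max ?Q - 1]) ! i" if "i < length ns" for i
      using that by (simp add: chain_prod_iff)
    have "xs ! i < ns ! i" if "i < length ns" for i
      using bound[OF that] that by (cases "i = Max ?Q") auto
    moreover have "xs ! Max ?Q \<noteq> ns ! Max ?Q - 1"
      using bound[OF q(1)] q by simp
    ultimately show "xs \<in> {xs \<in> chain_prod ns. xs ! Max ?Q \<noteq> ns ! Max ?Q - 1}"
      using xs by (simp add: chain_prod_iff)
  qed
  finally show ?thesis using q by blast
qed

lemma poset_iso_covers:
  assumes "poset_iso \<phi> P r Q s" "x \<in> P" "y \<in> P"
  shows "(x, y) \<in> covers P r \<longleftrightarrow> (\<phi> x, \<phi> y) \<in> covers Q s"
proof -
  have Q: "Q = \<phi> ` P" and inj: "inj_on \<phi> P"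
    and ord: "\<And>x y. x \<in> P \<Longrightarrow> y \<in> P \<Longrightarrow> (x, y) \<in> r \<longleftrightarrow> (\<phi> x, \<phi> y) \<in> s"
    using assms(1) by (auto simp: poset_iso_def bij_betw_def)
  show ?thesis
    using assms(2,3) by (simp add: covers_def Q ord inj_on_eq_iff[OF inj])
qed

text \<open>\<open>rank_in\<close> is a choice, so its values must be forced. Transporting
  \<open>sum_list\<close> shows that a rank function exists; covers determine any rank function from
  its value at the bottom, and that value is 0 because 0 is attained.\<close>

lemma chain_prod_iso_rank:
  assumes ns: "chain_sizes ns" and iso: "poset_iso \<phi> (chain_prod ns) (chain_prod_ord ns) P r"
  shows rank_in_chain_prod: "xs \<in> chain_prod ns \<Longrightarrow> rank_in P r (\<phi> xs) = sum_list xs"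
    and poset_length_chain_prod: "poset_length P r = sum_list ns - length ns"
proof -
  let ?C = "chain_prod ns" and ?L = "sum_list ns - length ns"
  have P: "P = \<phi> ` ?C" and inj: "inj_on \<phi> ?C"
    using iso by (auto simp: poset_iso_def bij_betw_def)
  let ?f = "\<lambda>p. sum_list (inv_into ?C \<phi> p)"
  have f: "?f (\<phi> xs) = sum_list xs" if "xs \<in> ?C" for xs
    using inv_into_f_f[OF inj that] by simp
  have "is_rank_function P r ?f ?L"
    unfolding is_rank_function_def
  proof (intro conjI ballI, goal_cases)
    case 1
    have "?f ` P = sum_list ` ?C" unfolding P image_image using f by (intro image_cong) auto
    then show ?case using sum_list_chain_prod[OF ns] by simp
  next
    case (2 e)
    then obtain xs ys where xy: "e = (\<phi> xs, \<phi> ys)" "xs \<in> ?C" "ys \<in> ?C"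
      by (auto simp: covers_def P)
    then have "(xs, ys) \<in> covers ?C (chain_prod_ord ns)"
      using 2 poset_iso_covers[OF iso] by blast
    then show ?case using xy f chain_prod_covers_sum_list by simp
  qed
  then have "\<exists>\<rho> l. is_rank_function P r \<rho> l" by blast
  then have "\<exists>l. is_rank_function P r (rank_in P r) l"
    unfolding rank_in_def by (rule someI_ex)
  then obtain l where image: "rank_in P r ` P = {0..l}"
    and covers: "\<And>s t. (s, t) \<in> covers P r \<Longrightarrow> rank_in P r t = Suc (rank_in P r s)"
    by (fastforce simp: is_rank_function_def)
  let ?b = "rank_in P r (\<phi> (replicate (length ns) 0))"
  have from_bottom: "rank_in P r (\<phi> xs) = ?b + sum_list xs" if "xs \<in> ?C" for xs
    using that
  proof (induction rule: chain_prod_induct)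
    case (cover xs ys)
    then have "(\<phi> xs, \<phi> ys) \<in> covers P r"
      using poset_iso_covers[OF iso] by (auto simp: covers_def)
    then show ?case
      using covers cover chain_prod_covers_sum_list by simp
  qed simp
  have "0 \<in> rank_in P r ` P" using image by simp
  then have "?b = 0" using from_bottom by (auto simp: P)
  then show rank: "rank_in P r (\<phi> xs) = sum_list xs" if "xs \<in> ?C" for xs
    using from_bottom that by simp
  have "rank_in P r ` (\<phi> ` ?C) = sum_list ` ?C"
    unfolding image_image using rank by (intro image_cong) auto
  then have "rank_in P r ` P = {0..?L}"
    by (simp add: sum_list_chain_prod[OF ns] flip: P)
  then show "poset_length P r = ?L"
    by (auto simp: poset_length_def intro: Max_eqI)
qed

section \<open>Monochromatic components\<close>

lemma color_comp_eq:
  assumes "y \<in> color_comp R r col i x"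
  shows "color_comp R r col i y = color_comp R r col i x"
proof -
  let ?E = "(edges R r col i \<union> (edges R r col i)\<inverse>)\<^sup>*"
  have "sym ?E" by (intro sym_rtrancl sym_Un_converse)
  moreover have "(x, y) \<in> ?E" using assms by (simp add: color_comp_def)
  ultimately have "(y, x) \<in> ?E" by (rule symD)
  with \<open>(x, y) \<in> ?E\<close> show ?thesis
    by (auto simp: color_comp_def intro: rtrancl_trans)
qed

lemma color_comp_self: "x \<in> color_comp R r col i x"
  by (simp add: color_comp_def)

text \<open>The first edge of an ascending path from \<open>s\<close> to \<open>t\<close> ends
  between them and not at \<open>s\<close>, hence at \<open>t\<close>.\<close>

lemma color_comp_covers:
  assumes "(s, t) \<in> covers (color_comp R r col i x) (comp_ord R r col i x)"
  shows "(s, t) \<in> edges R r col i"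
proof -
  let ?C = "color_comp R r col i x" and ?E = "edges R r col i"
  have st: "s \<in> ?C" "t \<in> ?C" "(s, t) \<in> ?E\<^sup>*" "s \<noteq> t"
    using assms by (auto simp: covers_def comp_ord_def)
  then obtain u where u: "(s, u) \<in> ?E" "(u, t) \<in> ?E\<^sup>*"
    by (meson converse_rtranclE)
  have "u \<in> ?C"
    using st(1) u(1) unfolding color_comp_def by (auto intro: rtrancl_into_rtrancl)
  moreover have "u \<noteq> s" using u(1) by (auto simp: edges_def covers_def)
  ultimately have "u = t"
    using assms u st by (auto simp: covers_def comp_ord_def)
  then show ?thesis using u by simp
qed

text \<open>Kindred sets are the classes of an equivalence relation, which lets a sum over
  \<open>R - S\<close> be grouped by them.\<close>

lemma kindred_eq_iff:
  assumes "y \<in> R - S" "x \<in> R - S"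
  shows "kindred R r col S \<kappa> y = kindred R r col S \<kappa> x \<longleftrightarrow> y \<in> kindred R r col S \<kappa> x"
proof
  show "y \<in> kindred R r col S \<kappa> x" if "kindred R r col S \<kappa> y = kindred R r col S \<kappa> x"
    using that assms color_comp_self unfolding kindred_def by fastforce
next
  assume "y \<in> kindred R r col S \<kappa> x"
  then have "\<kappa> y = \<kappa> x" "y \<in> color_comp R r col (\<kappa> x) x"
    by (simp_all add: kindred_def)
  moreover from this(2) have "color_comp R r col (\<kappa> x) y = color_comp R r col (\<kappa> x) x"
    by (rule color_comp_eq)
  ultimately show "kindred R r col S \<kappa> y = kindred R r col S \<kappa> x"
    by (simp add: kindred_def)
qed

context based_root_system
begin

lemma wt_coroot:
  "i \<in> I \<Longrightarrow> wt I \<alpha> R r col x \<bullet> coroot (\<alpha> i) = of_int (comp_rank R r col i x - comp_depth R r col i x)"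
  unfolding wt_def by (rule combination_coroot)

lemma wt_weight: "wt I \<alpha> R r col x \<in> weight_lattice I \<alpha>"
  by (simp add: wt_def weight_lattice_iff combination_in_span combination_coroot)

text \<open>The simple reflection \<open>s\<^sub>k\<close> reverses the color \<open>k\<close> strings about the middle of the sub-face,
  because \<open>\<rho>\<close> shifts the middle of the component by half a step.\<close>

lemma sub_face_alternants_cancel:
  assumes structured: "structured_poset I \<alpha> R r col" and k: "k \<in> I"
    and face: "is_sub_face K (color_comp R r col k x) (comp_ord R r col k x)"
  shows "(\<Sum>y\<in>K. A (\<rho> + wt I \<alpha> R r col y)) = 0"
proof -
  let ?C = "color_comp R r col k x" and ?ord = "comp_ord R r col k x"
  let ?wt = "wt I \<alpha> R r col"
  obtain ns \<phi> where K: "K \<subseteq> ?C" and ns: "chain_sizes ns"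
    and iso: "poset_iso \<phi> (chain_prod ns) (chain_prod_ord ns) ?C ?ord"
    and K_face: "{xs \<in> chain_prod ns. \<phi> xs \<in> K} = sub_face ns"
    using face by (auto simp: is_sub_face_def)
  let ?P = "chain_prod ns" and ?L = "sum_list ns - length ns"
  have C: "?C = \<phi> ` ?P" and inj: "inj_on \<phi> ?P"
    using iso by (auto simp: poset_iso_def bij_betw_def)
  have sub: "sub_face ns \<subseteq> ?P" using K_face by blast
  have K_image: "K = \<phi> ` sub_face ns"
    using K C by (auto simp: K_face[symmetric])
  have sum_K: "(\<Sum>y\<in>K. A (\<rho> + ?wt y)) = (\<Sum>xs\<in>sub_face ns. A (\<rho> + ?wt (\<phi> xs)))"
    unfolding K_image using inj_on_subset[OF inj sub] by (simp add: sum.reindex)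
  show ?thesis
  proof (cases "\<exists>q<length ns. 2 \<le> ns ! q")
    case False
    then have "sub_face ns = {}" unfolding sub_face_def by (rule if_not_P)
    then show ?thesis using sum_K by simp
  next
    case True
    then obtain q where q: "q < length ns" "2 \<le> ns ! q"
      and face_eq: "sub_face ns = chain_prod (ns[q := ns ! q - 1])"
      using sub_face_eq_chain_prod by blast
    \<comment> \<open>Reversal is taken within the sub-face, the product with sizes
      \<open>ms\<close>, and not within the whole component.\<close>
    define ms where "ms = ns[q := ns ! q - 1]"
    have "ns ! q \<le> sum_list ns" using q(1) by (intro member_le_sum_list) auto
    then have sum_ms: "sum_list ms + 1 = sum_list ns" "length ms = length ns"
      using q by (auto simp: ms_def sum_list_update)
    have rank: "comp_rank R r col k (\<phi> xs) = int (sum_list xs)"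
      and depth: "comp_depth R r col k (\<phi> xs) = int ?L - int (sum_list xs)" if xs: "xs \<in> ?P" for xs
    proof -
      have "color_comp R r col k (\<phi> xs) = ?C" using C xs by (intro color_comp_eq) blast
      moreover from this have "comp_ord R r col k (\<phi> xs) = ?ord" by (simp add: comp_ord_def)
      ultimately show "comp_rank R r col k (\<phi> xs) = int (sum_list xs)"
        "comp_depth R r col k (\<phi> xs) = int ?L - int (sum_list xs)"
        using rank_in_chain_prod[OF ns iso xs] poset_length_chain_prod[OF ns iso]
        by (simp_all add: comp_depth_def comp_rank_def comp_length_def)
    qed
    let ?b = "?wt (\<phi> (replicate (length ns) 0))"
    \<comment> \<open>Within the component the weight depends on the rank alone and moves in steps
      of \<open>\<alpha> k\<close>.\<close>
    have wt_eq: "?wt (\<phi> xs) = ?b + real (sum_list xs) *\<^sub>R \<alpha> k" if "xs \<in> ?P" for xs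
      using that
    proof (induction rule: chain_prod_induct)
      case (cover xs ys)
      then have "(\<phi> xs, \<phi> ys) \<in> covers ?C ?ord"
        using poset_iso_covers[OF iso] by (auto simp: covers_def)
      then have "(\<phi> xs, \<phi> ys) \<in> edges R r col k" by (rule color_comp_covers)
      then have "?wt (\<phi> xs) + \<alpha> k = ?wt (\<phi> ys)"
        using structured k by (auto simp: structured_poset_def)
      then show ?case
        using cover.IH chain_prod_covers_sum_list[OF cover.hyps] by (simp add: algebra_simps)
    qed simp
    have flip: "reflection (\<alpha> k) (\<rho> + ?wt (\<phi> xs)) = \<rho> + ?wt (\<phi> (chain_flip ms xs))"
      if xs: "xs \<in> sub_face ns" for xs
    proof -
      have xs': "xs \<in> chain_prod ms" using xs face_eq by (simp add: ms_def)
      have mem: "xs \<in> ?P" "chain_flip ms xs \<in> ?P"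
        using xs chain_flip_in[OF xs'] sub face_eq by (auto simp: ms_def)
      \<comment> \<open>The extra 1 comes from the removed top; it cancels the 1 that
        \<open>\<rho>\<close> adds to the coroot pairing.\<close>
      have L: "int ?L = int (sum_list xs) + int (sum_list (chain_flip ms xs)) + 1"
        using sum_list_chain_flip[OF xs'] sum_ms by simp
      have "(\<rho> + ?wt (\<phi> xs)) \<bullet> coroot (\<alpha> k) = 1 + real_of_int (2 * int (sum_list xs) - int ?L)"
        by (simp only: inner_add_left rho_coroot[OF k] wt_coroot[OF k] rank[OF mem(1)] depth[OF mem(1)])
      also have "\<dots> = real (sum_list xs) - real (sum_list (chain_flip ms xs))"
        unfolding L by simp
      finally show ?thesis
        by (simp only: reflection_def) (simp add: wt_eq[OF mem(1)] wt_eq[OF mem(2)] algebra_simps)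
    qed
    let ?T = "\<Sum>xs\<in>sub_face ns. A (\<rho> + ?wt (\<phi> xs))"
    have "bij_betw (chain_flip ms) (sub_face ns) (sub_face ns)"
      unfolding face_eq ms_def[symmetric]
      by (rule bij_betwI[of _ _ _ "chain_flip ms"]) (auto simp: chain_flip_in chain_flip_flip)
    then have "?T = (\<Sum>xs\<in>sub_face ns. A (\<rho> + ?wt (\<phi> (chain_flip ms xs))))"
      by (rule sum.reindex_bij_betw[symmetric])
    also have "\<dots> = (\<Sum>xs\<in>sub_face ns. - A (\<rho> + ?wt (\<phi> xs)))"
      using alternant_reflection[OF simple_root[OF k] simple_nonzero[OF k]] flip
      by (intro sum.cong refl) metis
    finally have "?T = - ?T" by (simp add: sum_negf)
    then have "?T = 0" by (rule poly_mapping_eq_uminus_imp_zero)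
    then show ?thesis using sum_K by simp
  qed
qed

end

theorem corollary8p2:
  fixes \<Phi> :: "(real^'n) set" and I :: "'i set" and \<alpha> :: "'i \<Rightarrow> real^'n"
    and R :: "'r set" and r :: "'r rel" and col :: "'r \<times> 'r \<Rightarrow> 'i"
    and S :: "'r set" and \<kappa> :: "'r \<Rightarrow> 'i"
  assumes "root_system \<Phi>" and "simple_roots \<Phi> I \<alpha>"
    and "structured_poset I \<alpha> R r col"
    and "weyl_invariant \<Phi> (WGF I \<alpha> R r col)"
    and "S \<subseteq> {x \<in> R. \<forall>i\<in>I. comp_depth R r col i x = 0}"
    and "\<kappa> \<in> (R - S) \<rightarrow> I"
    and "\<And>x. x \<in> R - S \<Longrightarrow>
           iso_chain_prod (color_comp R r col (\<kappa> x) x) (comp_ord R r col (\<kappa> x) x)"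
    and "\<And>x. x \<in> R - S \<Longrightarrow>
           is_sub_face (kindred R r col S \<kappa> x) (color_comp R r col (\<kappa> x) x) (comp_ord R r col (\<kappa> x) x)"
  shows "(\<forall>s\<in>S. wt I \<alpha> R r col s \<in> dominant_weights I \<alpha>) \<and>
    splitting_poset \<Phi> I \<alpha> R r col S \<and>
    WGF I \<alpha> R r col = (\<Sum>s\<in>S. bialternant \<Phi> I \<alpha> (wt I \<alpha> R r col s))"
proof -
  interpret based_root_system \<Phi> I \<alpha>
    using assms(1,2) by unfold_locales
  let ?wt = "wt I \<alpha> R r col" and ?F = "\<lambda>x. A (\<rho> + wt I \<alpha> R r col x)"
  have finite_R: "finite R"
    using assms(3) by (auto simp: structured_poset_def colored_ranked_poset_def ranked_poset_def)
  have S: "S \<subseteq> R" using assms(5) by blast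
  have dominant: "?wt s \<in> dominant_weights I \<alpha>" if s: "s \<in> S" for s
    unfolding dominant_weights_iff
  proof (intro conjI ballI wt_weight)
    fix i assume i: "i \<in> I"
    have "comp_depth R r col i s = 0" using s i assms(5) by blast
    \<comment> \<open>At depth 0 the coordinate of the weight is the rank, a natural number.\<close>
    then have "0 \<le> ?wt s \<bullet> coroot (\<alpha> i)"
      using wt_coroot[OF i, of R r col s] by (simp add: comp_rank_def)
    then show "0 \<le> ?wt s \<bullet> \<alpha> i" using coroot_inner_nonneg_iff[OF simple_nonzero[OF i]] by simp
  qed
  \<comment> \<open>The sum is grouped by kindred set; each fibre of \<open>kindred\<close> is the
    kindred set itself, and its alternants cancel.\<close>
  have "(\<Sum>x\<in>R - S. ?F x) =
      (\<Sum>K\<in>kindred R r col S \<kappa> ` (R - S). \<Sum>y\<in>{y \<in> R - S. kindred R r col S \<kappa> y = K}. ?F y)"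
    using finite_R by (intro sum.image_gen) simp
  also have "\<dots> = 0"
  proof (rule sum.neutral, rule ballI)
    fix K assume "K \<in> kindred R r col S \<kappa> ` (R - S)"
    then obtain x where x: "x \<in> R - S" "K = kindred R r col S \<kappa> x" by blast
    have "{y \<in> R - S. kindred R r col S \<kappa> y = K} = K"
    proof -
      have "K \<subseteq> R - S" by (auto simp: x(2) kindred_def)
      then show ?thesis using kindred_eq_iff[OF _ x(1), of _ r col \<kappa>] x(2) by blast
    qed
    moreover have "(\<Sum>y\<in>K. ?F y) = 0"
      unfolding x(2) using x(1) assms(6,8) by (intro sub_face_alternants_cancel[OF assms(3)]) auto
    ultimately show "(\<Sum>y\<in>{y \<in> R - S. kindred R r col S \<kappa> y = K}. ?F y) = 0" by simp
  qed
  finally have vanish: "(\<Sum>x\<in>R - S. ?F x) = 0" .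
  have "A \<rho> * WGF I \<alpha> R r col = (\<Sum>x\<in>R. ?F x)"
    using assms(4) unfolding WGF_def by (rule alternant_mult_invariant)
  also have "\<dots> = (\<Sum>s\<in>S. ?F s)"
    using vanish sum.subset_diff[OF S finite_R, of ?F] by simp
  also have "\<dots> = (\<Sum>s\<in>S. A \<rho> * bialternant \<Phi> I \<alpha> (?wt s))"
    using alternant_mult_bialternant[OF dominant] by (intro sum.cong) (simp_all add: add.commute)
  also have "\<dots> = A \<rho> * (\<Sum>s\<in>S. bialternant \<Phi> I \<alpha> (?wt s))"
    by (simp add: sum_distrib_left)
  finally have "WGF I \<alpha> R r col = (\<Sum>s\<in>S. bialternant \<Phi> I \<alpha> (?wt s))"
    by (rule alternant_rho_cancel)
  then show ?thesis
    using dominant S assms(3) by (simp add: splitting_poset_def)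
qed

end
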